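(* Let $p$ be a prime and $n$ an integer, with $n\ge 2$ if $p$ is odd and $n\ge 3$ if $p=2$. Let $\theta$ be a primitive $p^n$-th root of unity, $C_{p^n}=\langle g\rangle$ the cyclic group of order $p^n$, and $\kappa=\frac{\phi(p^n)}{2}-1$. Let $t$ be a positive integer such that $\bar t$ generates $\mathcal{U}(\mathbb{Z}_{p^n})$ if $p$ is odd, and $t=3$ if $p=2$. Assume that the set $\{-1,\theta\}\cup\{\mu_i : 1<i<\frac{p^n}{2},\ \gcd(i,p^n)=1\}$ generates $\mathcal{U}(\mathbb{Z}[\theta])$, and assume that $(-1)^p(\mu_t)^{\frac{\phi(p^n)}{2p}}\notin \mathrm{Im}(\overline{\pi}_1)$. Let $S=\{g,\vartheta_1,\vartheta_2,\dots,\vartheta_\kappa\}\subseteq\mathcal{U}_1(\mathbb{Z}C_{p^n})$, where $$\vartheta_i=(1+g^t+g^{2t}+\cdots+g^{(r-1)t})(1+g^{t^i}+g^{2t^i}+\cdots+g^{(t-1)t^i})-\frac{tr-1}{p^n}\,\widehat{g},$$ $r$ is the least positive integer with $tr\equiv 1\pmod{p^n}$, and $\widehat g=1+g+\cdots+g^{p^n-1}$. Let $\mathcal{U}_0=\{\theta,h_1,h_2,\dots,h_\kappa\}\subseteq\mathcal{U}(\mathbb{Z}[\theta])$. Then $\langle S\rangle\cong\langle \mathcal{U}_0\rangle$ as groups.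
   Context: $\phi$ is Euler's totient; $\mathbb{Z}_m=\mathbb{Z}/m\mathbb{Z}$; $\mathcal{U}(R)$ is the unit group of a ring $R$; $\mathcal{U}_1(\mathbb{Z}C_{p^n})$ is the group of units of $\mathbb{Z}C_{p^n}$ of augmentation $1$. For a positive integer $i$, $\mu_i=1+\theta+\cdots+\theta^{i-1}$. For a positive integer $q$ and an integer $s$, both prime to $p$, $\omega_{q,s}=1+\theta^s+\theta^{2s}+\cdots+\theta^{(q-1)s}$, a unit of $\mathbb{Z}[\theta]$; and $h_i=\omega_{t,1}^{-1}\omega_{t,t^i}$. The map $\overline{\pi}_1:\mathcal{U}_1(\mathbb{Z}C_{p^n})\to\mathcal{U}(\mathbb{Z}[\theta])$ is the restriction of the ring homomorphism $\pi_1:\mathbb{Z}C_{p^n}\to\mathbb{Z}[\theta]$ with $\pi_1(g)=\theta$. The elements $\vartheta_i$ (Hoechsmann units) are normalized units of $\mathbb{Z}C_{p^n}$. *)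

theory Defs
  imports
    "HOL-Number_Theory.Residues"
    "HOL-Algebra.Algebraic_Closure_Type"
    "HOL-Algebra.Generated_Rings"
    "HOL-Algebra.Elementary_Groups"
    "HOL-Library.Poly_Mapping"
begin

text \<open>
  The integral group ring of \<open>G\<close>: finite formal integer combinations of elements of \<open>G\<close>,
  where \<^term>\<open>frag_of h\<close> is the group element \<open>h\<close> viewed in the group ring.  Multiplication
  is the bilinear extension of the multiplication of \<open>G\<close>.
\<close>

definition group_ring :: "('a, 'b) monoid_scheme \<Rightarrow> ('a \<Rightarrow>\<^sub>0 int) ring" where
  "group_ring G =
     \<lparr>carrier = {x. Poly_Mapping.keys x \<subseteq> carrier G},
      monoid.mult = (\<lambda>x y. frag_extend (\<lambda>h. frag_extend (\<lambda>k. frag_of (h \<otimes>\<^bsub>G\<^esub> k)) y) x),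
      one = frag_of \<one>\<^bsub>G\<^esub>,
      zero = 0,
      add = (+)\<rparr>"

lemma ring_group_ring:
  assumes "group G"
  shows "ring (group_ring G)"
proof -
  interpret group G by fact
  define M where
    "M x y = frag_extend (\<lambda>h. frag_extend (\<lambda>k. frag_of (h \<otimes>\<^bsub>G\<^esub> k)) y) x" for x y
  have Mof: "M (frag_of h) (frag_of k) = frag_of (h \<otimes>\<^bsub>G\<^esub> k)" for h k
    by (simp add: M_def)
  have cmul_diff: "frag_cmul c (a - b) = frag_cmul c a - frag_cmul c b"
    for c and a b :: "'a \<Rightarrow>\<^sub>0 int"
    by (rule poly_mapping_eqI) (simp add: lookup_minus right_diff_distrib)
  have Ml: "M (x - y) z = M x z - M y z" and Mla: "M (x + y) z = M x z + M y z" for x y z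
    by (simp_all add: M_def frag_extend_diff frag_extend_add)
  have Mr: "M z (x - y) = M z x - M z y" and Mra: "M z (x + y) = M z x + M z y" for x y z
    unfolding M_def frag_extend_diff frag_extend_add
    by (simp_all add: frag_extend_def[of _ z] cmul_diff frag_cmul_distrib2 sum.distrib sum_subtractf)
  have Mz: "M 0 z = 0" "M z 0 = 0" for z
    by (simp_all add: M_def frag_extend_eq_0)
  have closed: "Poly_Mapping.keys (M x y) \<subseteq> carrier G"
    if "Poly_Mapping.keys x \<subseteq> carrier G" "Poly_Mapping.keys y \<subseteq> carrier G" for x y
    using that(1)
  proof (induction x rule: frag_induction)
    case (one h)
    show ?case using that(2)
      by (induction y rule: frag_induction)
         (use one in \<open>auto simp: Mz Mof Mr dest!: keys_diff[THEN subsetD]\<close>)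
  qed (auto simp: Mz Ml dest!: keys_diff[THEN subsetD])
  have assoc: "M (M x y) z = M x (M y z)"
    if x: "Poly_Mapping.keys x \<subseteq> carrier G" and y: "Poly_Mapping.keys y \<subseteq> carrier G"
      and z: "Poly_Mapping.keys z \<subseteq> carrier G" for x y z
    using x
  proof (induction x rule: frag_induction)
    case (one h)
    note h = this
    show ?case using y
    proof (induction y rule: frag_induction)
      case (one k)
      show ?case using z
        by (induction z rule: frag_induction) (use h one in \<open>auto simp: Mz Mof Mr m_assoc\<close>)
    qed (auto simp: Mz Ml Mr)
  qed (auto simp: Mz Ml)
  have l_one: "M (frag_of \<one>\<^bsub>G\<^esub>) x = x" if "Poly_Mapping.keys x \<subseteq> carrier G" for x
    using that by (induction x rule: frag_induction) (auto simp: Mz Mof Mr)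
  have r_one: "M x (frag_of \<one>\<^bsub>G\<^esub>) = x" if "Poly_Mapping.keys x \<subseteq> carrier G" for x
    using that by (induction x rule: frag_induction) (auto simp: Mz Mof Ml)
  show ?thesis
  proof (rule ringI)
    show "abelian_group (group_ring G)"
    proof (rule abelian_groupI)
      fix x assume "x \<in> carrier (group_ring G)"
      then show "\<exists>y\<in>carrier (group_ring G). y \<oplus>\<^bsub>group_ring G\<^esub> x = \<zero>\<^bsub>group_ring G\<^esub>"
        by (intro bexI[of _ "-x"]) (auto simp: group_ring_def)
    qed (auto simp: group_ring_def ac_simps dest: keys_add[THEN subsetD])
    show "monoid (group_ring G)"
      by (rule monoidI)
         (auto simp: group_ring_def M_def[symmetric] assoc l_one r_one
            dest: closed[THEN subsetD, rotated 2])
  qed (auto simp: group_ring_def M_def[symmetric] Mla Mra)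
qed

definition augmentation :: "('a \<Rightarrow>\<^sub>0 int) \<Rightarrow> int" where
  "augmentation x = (\<Sum>h\<in>Poly_Mapping.keys x. Poly_Mapping.lookup x h)"

definition normalized_units :: "('a, 'b) monoid_scheme \<Rightarrow> ('a \<Rightarrow>\<^sub>0 int) monoid" where
  "normalized_units G =
     (units_of (group_ring G))\<lparr>carrier := {u \<in> Units (group_ring G). augmentation u = 1}\<rparr>"

text \<open>
  \<open>\<int>[\<theta>]\<close>, as the subring of \<open>\<complex>\<close> generated by \<open>\<theta>\<close>.
\<close>

definition int_adjoin :: "complex \<Rightarrow> complex ring" where
  "int_adjoin \<theta> = ring_of_type_algebra\<lparr>carrier := generate_ring ring_of_type_algebra {\<theta>}\<rparr>"

definition primitive_root_of_unity :: "nat \<Rightarrow> complex \<Rightarrow> bool" where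
  "primitive_root_of_unity m \<theta> \<longleftrightarrow> 0 < m \<and> \<theta> ^ m = 1 \<and> (\<forall>k. 0 < k \<and> k < m \<longrightarrow> \<theta> ^ k \<noteq> 1)"

definition cyc_mu :: "complex \<Rightarrow> nat \<Rightarrow> complex" where
  "cyc_mu \<theta> i = (\<Sum>j<i. \<theta> ^ j)"

definition cyc_omega :: "complex \<Rightarrow> nat \<Rightarrow> int \<Rightarrow> complex" where
  "cyc_omega \<theta> q s = (\<Sum>j<q. \<theta> powi (int j * s))"

definition cyc_h :: "complex \<Rightarrow> nat \<Rightarrow> nat \<Rightarrow> complex" where
  "cyc_h \<theta> t i = inverse (cyc_omega \<theta> t 1) * cyc_omega \<theta> t (int (t ^ i))"

text \<open>
  Intended for \<open>g\<close> generating the cyclic group \<open>G\<close> of order \<open>m\<close> and \<open>t * r \<equiv> 1\<close> modulo \<open>m\<close>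
  with \<open>r > 0\<close>, so that the truncated subtraction and the division are exact.
\<close>

definition hoechsmann_unit ::
    "('a, 'b) monoid_scheme \<Rightarrow> 'a \<Rightarrow> nat \<Rightarrow> nat \<Rightarrow> nat \<Rightarrow> nat \<Rightarrow> ('a \<Rightarrow>\<^sub>0 int)" where
  "hoechsmann_unit G g m t r i =
     (\<Sum>j<r. frag_of (g [^]\<^bsub>G\<^esub> (j * t))) \<otimes>\<^bsub>group_ring G\<^esub> (\<Sum>j<t. frag_of (g [^]\<^bsub>G\<^esub> (j * t ^ i)))
     - frag_cmul (int ((t * r - 1) div m)) (\<Sum>j<m. frag_of (g [^]\<^bsub>G\<^esub> j))"

end

theory Submission
  imports Defs "HOL-Computational_Algebra.Polynomial_Factorial"
begin

text \<open>
  The isomorphism is \<open>\<pi>\<^sub>1\<close> itself. Since \<open>t * r \<equiv> 1\<close> modulo \<open>p ^ n\<close>, the first factor of a Hoechsmann unit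
  evaluates at \<open>\<theta>\<close> to \<open>(\<theta> - 1) / (\<theta> ^ t - 1)\<close>, the inverse of \<open>\<omega>\<^bsub>t,1\<^esub>\<close>, and the correction term vanishes,
  because the powers of \<open>\<theta>\<close> sum to \<open>0\<close>. So \<open>\<pi>\<^sub>1\<close> takes \<open>\<vartheta>\<^sub>i\<close> to \<open>h\<^sub>i\<close> and \<open>\<langle>S\<rangle>\<close> onto \<open>\<langle>\<U>\<^sub>0\<rangle>\<close>. All the content is
  that \<open>\<pi>\<^sub>1\<close> is injective on \<open>\<langle>S\<rangle>\<close>, although it is far from injective on the whole group ring.

  An element \<open>u\<close> of the group ring is determined by its values \<open>u(z)\<close> at all \<open>p ^ n\<close>-th roots of
  unity \<open>z\<close>, where \<open>u(z)\<close> arises by substituting \<open>z\<close> for \<open>g\<close>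
  (\<open>char_eval_joint_injective\<close>). If \<open>u(\<theta>) = 1\<close>, then \<open>u(z) = 1\<close> at every primitive root \<open>z\<close>, because these
  are conjugate over \<open>\<rat>\<close> (\<open>int_poly_eval_conjugate_root\<close>, which rests on Eisenstein's criterion);
  and \<open>u(1)\<close> is the augmentation, hence \<open>1\<close> for a normalized unit. The roots of unity in between are
  reached because the elements of \<open>\<langle>S\<rangle>\<close> are compatible with norms: for \<open>z ^ p \<noteq> 1\<close>, the product of the values
  \<open>u(y)\<close> over the \<open>p\<close> solutions of \<open>y ^ p = z ^ p\<close> is \<open>u(z ^ p)\<close>, up to a sign. For \<open>\<vartheta>\<^sub>i\<close> this is the identity
  \<open>\<Prod>\<^sub>y (1 - y) = 1 - z ^ p\<close>, applied to the four factors of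
  \<open>\<vartheta>\<^sub>i(z) = (z - 1) (z ^ t ^ (i+1) - 1) / ((z ^ t - 1) (z ^ t ^ i - 1))\<close>
  (\<open>cyclotomic_quotient_norm\<close>). Both sides being multiplicative, the relation passes to all of \<open>\<langle>S\<rangle>\<close>,
  and the values \<open>1\<close> descend from the primitive roots to the roots of order \<open>p ^ (n-1)\<close>, \<open>p ^ (n-2)\<close>, \<open>\<dots>\<close>, \<open>p\<close>
  (\<open>norm_compatible_kernel_trivial\<close>).

  The sign is trivial for odd \<open>p\<close>. For \<open>p = 2\<close> the generator \<open>g\<close> contributes \<open>-1\<close> and the \<open>\<vartheta>\<^sub>i\<close>
  contribute \<open>1\<close>. This sign can be read off from \<open>x = u(\<theta>)\<close> alone, as the power of exponent
  \<open>2 ^ n / 4\<close> of \<open>x / cnj x\<close>; so it is trivial as soon as \<open>u(\<theta>) = 1\<close>.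
\<close>

section \<open>Irreducibility of the cyclotomic polynomial of prime power order\<close>

text \<open>
  If \<open>q\<close> divides the constant coefficient of one factor, it does not divide that of the other. The
  first coefficient of the former that \<open>q\<close> does not divide then survives modulo \<open>q\<close> in the product, so it sits
  in the top degree, and the other factor is constant.
\<close>

lemma eisenstein_criterion:
  fixes A B :: "int poly" and q :: int
  assumes q: "Factorial_Ring.prime q"
    and low: "\<And>i. i < Polynomial.degree (A * B) \<Longrightarrow> q dvd Polynomial.coeff (A * B) i"
    and lead: "\<not> q dvd lead_coeff (A * B)"
    and const: "\<not> q\<^sup>2 dvd Polynomial.coeff (A * B) 0"
  shows "Polynomial.degree A = 0 \<or> Polynomial.degree B = 0"
proof (rule ccontr)
  assume "\<not> ?thesis"
  hence pos: "Polynomial.degree A > 0" "Polynomial.degree B > 0" by auto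
  have *: False
    if AB: "A' * B' = A * B" and B': "Polynomial.degree B' > 0" and dvd: "q dvd Polynomial.coeff A' 0"
    for A' B' :: "int poly"
  proof -
    have nz: "A' \<noteq> 0" "B' \<noteq> 0" using lead AB by auto
    have deg: "Polynomial.degree (A * B) = Polynomial.degree A' + Polynomial.degree B'"
      using nz by (simp add: AB[symmetric] degree_mult_eq)
    have nB: "\<not> q dvd Polynomial.coeff B' 0"
    proof
      assume "q dvd Polynomial.coeff B' 0"
      hence "q * q dvd Polynomial.coeff A' 0 * Polynomial.coeff B' 0" using dvd by (rule mult_dvd_mono[rotated])
      thus False using const by (simp add: AB[symmetric] coeff_mult_0 power2_eq_square)
    qed
    define i where "i = (LEAST i. \<not> q dvd Polynomial.coeff A' i)"
    have "\<not> q dvd lead_coeff A'"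
      using lead by (auto simp: AB[symmetric] lead_coeff_mult)
    hence i: "\<not> q dvd Polynomial.coeff A' i" and i_le: "i \<le> Polynomial.degree A'"
      unfolding i_def by (rule LeastI, rule Least_le)
    have less: "q dvd Polynomial.coeff A' k" if "k < i" for k
      using not_less_Least[of k] that unfolding i_def by blast
    have "q dvd Polynomial.coeff (A' * B') i"
      using low[of i] deg B' i_le AB by simp
    also have "Polynomial.coeff (A' * B') i
        = (\<Sum>k<i. Polynomial.coeff A' k * Polynomial.coeff B' (i - k)) + Polynomial.coeff A' i * Polynomial.coeff B' 0"
      by (simp add: coeff_mult lessThan_Suc_atMost[symmetric])
    finally have "q dvd Polynomial.coeff A' i * Polynomial.coeff B' 0"
      using less by (subst (asm) dvd_add_right_iff) (auto intro!: dvd_sum)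
    thus False using q i nB by (simp add: prime_dvd_mult_iff)
  qed
  have "q dvd Polynomial.coeff (A * B) 0" using low[of 0] pos lead
    by (metis add_gr_0 degree_mult_eq dvd_0_right leading_coeff_0_iff mult_zero_left mult_zero_right)
  hence "q dvd Polynomial.coeff A 0 \<or> q dvd Polynomial.coeff B 0"
    using q by (simp add: coeff_mult_0 prime_dvd_mult_iff)
  thus False using *[of A B] *[of B A] pos by (auto simp: mult.commute)
qed

abbreviation int_poly_eval :: "int poly \<Rightarrow> complex \<Rightarrow> complex" where
  "int_poly_eval P z \<equiv> poly (map_poly of_int P) z"

lemma int_poly_eval_mult: "int_poly_eval (P * Q) z = int_poly_eval P z * int_poly_eval Q z"
proof -
  have "map_poly of_int (P * Q) = (map_poly of_int P * map_poly of_int Q :: complex poly)"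
    by (rule poly_eqI) (simp add: coeff_map_poly coeff_mult)
  thus ?thesis by simp
qed

lemma int_poly_eval_add: "int_poly_eval (P + Q) z = int_poly_eval P z + int_poly_eval Q z"
proof -
  have "map_poly of_int (P + Q) = (map_poly of_int P + map_poly of_int Q :: complex poly)"
    by (rule poly_eqI) (simp add: coeff_map_poly)
  thus ?thesis by simp
qed

lemma int_poly_eval_smult: "int_poly_eval (Polynomial.smult c P) z = of_int c * int_poly_eval P z"
proof -
  have "map_poly of_int (Polynomial.smult c P) = (Polynomial.smult (of_int c) (map_poly of_int P) :: complex poly)"
    by (rule poly_eqI) (simp add: coeff_map_poly)
  thus ?thesis by simp
qed

lemma int_poly_eval_monom: "int_poly_eval (Polynomial.monom c k) z = of_int c * z ^ k"
  by (simp add: map_poly_monom poly_monom)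

lemma int_poly_eval_sum: "int_poly_eval (\<Sum>i\<in>I. P i) z = (\<Sum>i\<in>I. int_poly_eval (P i) z)"
  by (induction I rule: infinite_finite_induct) (simp_all add: int_poly_eval_add)

text \<open>
  Over \<open>\<int>\<close> there is no Euclidean division to produce a minimal polynomial of \<open>z\<close>. Instead, take any integer
  polynomial \<open>M \<noteq> 0\<close> of least degree with root \<open>z\<close>; pseudo-division shows that \<open>M\<close> divides a
  multiple of \<open>\<Phi>\<close>, and by Gauss's lemma its primitive part divides \<open>\<Phi>\<close>. Irreducibility forces
  \<open>\<Phi>\<close> to have that least degree too, and \<open>\<Phi>\<close>, being monic, can be used for honest division.
\<close>

lemma irreducible_monic_dvd_of_common_root:
  assumes irred: "\<And>A B. \<Phi> = A * B \<Longrightarrow> Polynomial.degree A = 0 \<or> Polynomial.degree B = 0"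
    and monic: "lead_coeff \<Phi> = 1"
    and \<Phi>: "int_poly_eval \<Phi> z = 0" and F: "int_poly_eval F z = 0"
  shows "\<Phi> dvd F"
proof -
  define d where "d = (LEAST d. \<exists>P. P \<noteq> 0 \<and> int_poly_eval P z = 0 \<and> Polynomial.degree P = d)"
  have \<Phi>0: "\<Phi> \<noteq> 0" using monic by auto
  have "\<exists>d P. P \<noteq> 0 \<and> int_poly_eval P z = 0 \<and> Polynomial.degree P = d"
    using \<Phi>0 \<Phi> by blast
  hence "\<exists>P. P \<noteq> 0 \<and> int_poly_eval P z = 0 \<and> Polynomial.degree P = d"
    unfolding d_def by (rule LeastI_ex)
  then obtain M where M: "M \<noteq> 0" "int_poly_eval M z = 0" "Polynomial.degree M = d" by blast
  have min: "P = 0" if "int_poly_eval P z = 0" "Polynomial.degree P < d" for P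
    using not_less_Least[OF that(2)[unfolded d_def]] that(1) by blast
  obtain c R Q where cRQ: "c \<noteq> 0" "Polynomial.smult c \<Phi> = M * Q + R" "R = 0 \<or> Polynomial.degree R < Polynomial.degree M"
    using pseudo_mod[OF M(1), of \<Phi>] by blast
  have "int_poly_eval R z = 0"
    using arg_cong[OF cRQ(2), of "\<lambda>P. int_poly_eval P z"] \<Phi> M(2)
    by (simp add: int_poly_eval_smult int_poly_eval_mult int_poly_eval_add)
  hence "R = 0" using cRQ(3) min M(3) by auto
  have content: "content \<Phi> = 1"
    using content_dvd_coeff[of \<Phi> "Polynomial.degree \<Phi>"] monic
    by (metis is_unit_content_iff)
  have "primitive_part (Polynomial.smult c \<Phi>) = primitive_part M * primitive_part Q"
    using cRQ(2) \<open>R = 0\<close> by (simp add: primitive_part_mult)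
  hence eq: "Polynomial.smult (unit_factor c) \<Phi> = primitive_part M * primitive_part Q"
    by (simp add: primitive_part_smult primitive_part_prim[OF content])
  have "unit_factor c * unit_factor c = 1" using cRQ(1) by (simp add: sgn_if)
  \<comment> \<open>The unit \<open>unit_factor c = \<plusminus>1\<close> is its own inverse and is moved to the first factor.\<close>
  hence "\<Phi> = Polynomial.smult (unit_factor c) (primitive_part M) * primitive_part Q"
    using arg_cong[OF eq, of "Polynomial.smult (unit_factor c)"] by simp
  hence "Polynomial.degree (Polynomial.smult (unit_factor c) (primitive_part M)) = 0
      \<or> Polynomial.degree (primitive_part Q) = 0" by (rule irred)
  moreover have "d \<noteq> 0"
  proof
    assume "d = 0"
    then obtain a where "M = [:a:]" using M(3) degree_eq_zeroE by blast
    with M(1,2) show False by (simp add: map_poly_pCons)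
  qed
  ultimately have "Polynomial.degree Q = 0" using M(3) cRQ(1) by (auto simp: sgn_if split: if_splits)
  moreover have "Polynomial.degree \<Phi> = Polynomial.degree M + Polynomial.degree Q"
    using cRQ(1,2) \<open>R = 0\<close> M(1) \<Phi>0
    by (metis add.right_neutral degree_mult_eq degree_smult_eq mult_zero_right smult_eq_0_iff)
  ultimately have deg: "Polynomial.degree \<Phi> = d" using M(3) by simp
  obtain F' R' where F': "pseudo_divmod F \<Phi> = (F', R')" by (cases "pseudo_divmod F \<Phi>")
  have "F = \<Phi> * F' + R'" "R' = 0 \<or> Polynomial.degree R' < Polynomial.degree \<Phi>"
    using pseudo_divmod[OF \<Phi>0 F'] by (simp_all add: monic)
  moreover from this have "int_poly_eval R' z = 0"
    using F \<Phi> by (simp add: int_poly_eval_mult int_poly_eval_add)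
  ultimately have "R' = 0" using min deg by blast
  thus "\<Phi> dvd F" using \<open>F = \<Phi> * F' + R'\<close> by simp
qed

definition prime_power_cyclotomic :: "nat \<Rightarrow> nat \<Rightarrow> int poly" where
  "prime_power_cyclotomic p n = (\<Sum>i<p. Polynomial.monom 1 (i * p ^ (n - 1)))"

text \<open>
  The Frobenius congruence. A single power with exponent \<open>p\<close> preserves sums because the inner binomial coefficients are
  divisible by \<open>p\<close>; congruences modulo \<open>p\<close> are stable under powers, so the step can be iterated.
\<close>

lemma poly_binomial_power_prime_power:
  fixes p k :: nat
  assumes "Factorial_Ring.prime p"
  shows "[:int p:] dvd (Polynomial.monom 1 1 + 1) ^ (p ^ k) - (Polynomial.monom 1 (p ^ k) + 1)"
proof (induction k)
  case 0
  show ?case by simp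
next
  case (Suc k)
  have cong_pow: "c dvd a ^ p - b ^ p" if "c dvd a - b" for a b c :: "int poly"
    using that by (metis dvd_trans dvd_triv_left power_diff_sumr2)
  let ?x = "Polynomial.monom (1::int) (p ^ k)"
  have "[:int p:] dvd ((Polynomial.monom 1 1 + 1) ^ (p ^ k)) ^ p - (?x + 1) ^ p"
    by (rule cong_pow) (rule Suc)
  moreover have "[:int p:] dvd (?x + 1) ^ p - (?x ^ p + 1)"
  proof -
    have p1: "p \<ge> 2" using assms by (rule prime_ge_2_nat)
    have "(?x + 1) ^ p = (\<Sum>j\<le>p. of_nat (p choose j) * ?x ^ j)"
      by (simp add: binomial_ring)
    also have "{..p} = insert 0 (insert p {1..<p})" using p1 by auto
    also have "(\<Sum>j\<in>\<dots>. of_nat (p choose j) * ?x ^ j)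
        = 1 + (?x ^ p + (\<Sum>j\<in>{1..<p}. of_nat (p choose j) * ?x ^ j))"
      using p1 by simp
    finally have eq: "(?x + 1) ^ p - (?x ^ p + 1) = (\<Sum>j\<in>{1..<p}. of_nat (p choose j) * ?x ^ j)"
      by simp
    have "[:int p:] dvd of_nat (p choose j) * ?x ^ j" if "j \<in> {1..<p}" for j
    proof -
      have "p dvd p choose j" using that assms by (intro dvd_choose_prime) auto
      then obtain c where "p choose j = p * c" by blast
      hence "(of_nat (p choose j) :: int poly) = [:int p:] * of_nat c" by (simp add: of_nat_poly)
      hence "(of_nat (p choose j) * ?x ^ j :: int poly) = [:int p:] * (of_nat c * ?x ^ j)"
        by (simp only: mult.assoc)
      thus ?thesis by (rule dvdI)
    qed
    thus ?thesis unfolding eq by (intro dvd_sum)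
  qed
  ultimately have "[:int p:] dvd (((Polynomial.monom 1 1 + 1) ^ (p ^ k)) ^ p - (?x + 1) ^ p)
      + ((?x + 1) ^ p - (?x ^ p + 1))" by (rule dvd_add)
  hence "[:int p:] dvd ((Polynomial.monom 1 1 + 1) ^ (p ^ k)) ^ p - (?x ^ p + 1)"
    by (simp only: add_diff_eq diff_add_cancel)
  thus ?case by (simp add: power_mult[symmetric] monom_power mult.commute)
qed

text \<open>
  Modulo \<open>p\<close> the shifted polynomial is a power of \<open>X\<close>, as Eisenstein's criterion requires: with
  \<open>q = p ^ (n - 1)\<close> the identity \<open>((X + 1) ^ q - 1) \<Psi> = (X + 1) ^ p ^ n - 1\<close> reduces to
  \<open>X ^ q \<Psi> \<equiv> X ^ p ^ n\<close>, and comparing coefficients cancels \<open>X ^ q\<close>.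
\<close>

lemma prime_power_cyclotomic_shift_coeffs:
  fixes p n :: nat
  assumes p: "Factorial_Ring.prime p" and n: "n > 0"
  defines "\<Psi> \<equiv> pcompose (prime_power_cyclotomic p n) [:1, 1:]"
  shows "int p dvd Polynomial.coeff \<Psi> i - (if i = (p - 1) * p ^ (n - 1) then 1 else 0)"
proof -
  define q where "q = p ^ (n - 1)"
  have p2: "p \<ge> 2" using p by (rule prime_ge_2_nat)
  have pq: "p * q = p ^ n" using n by (simp add: q_def power_eq_if)
  let ?y = "Polynomial.monom 1 1 + 1 :: int poly"
  have y: "[:1, 1:] = ?y" by (simp add: monom_altdef one_pCons)
  have "prime_power_cyclotomic p n = (\<Sum>i<p. Polynomial.monom 1 q ^ i)"
    unfolding prime_power_cyclotomic_def q_def by (simp add: monom_power mult.commute)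
  moreover have "pcompose (P ^ i) Q = pcompose P Q ^ i" for P Q :: "int poly" and i
    by (induction i) (simp_all add: pcompose_mult pcompose_1)
  ultimately have "\<Psi> = (\<Sum>i<p. (?y ^ q) ^ i)"
    unfolding \<Psi>_def y
    by (simp add: pcompose_sum monom_altdef pcompose_pCons one_pCons)
  hence "(?y ^ q - 1) * \<Psi> = (?y ^ q) ^ p - 1" by (simp only: power_diff_1_eq)
  also have "(?y ^ q) ^ p = ?y ^ (p ^ n)"
    by (simp only: power_mult[symmetric] pq[symmetric] mult.commute)
  finally have eq: "(?y ^ q - 1) * \<Psi> = ?y ^ (p ^ n) - 1" .
  have 1: "[:int p:] dvd \<Psi> * (?y ^ q - (Polynomial.monom 1 q + 1))"
    using poly_binomial_power_prime_power[OF p, of "n - 1"] unfolding q_def by (rule dvd_mult)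
  have 2: "[:int p:] dvd ?y ^ (p ^ n) - (Polynomial.monom 1 (p ^ n) + 1)"
    by (rule poly_binomial_power_prime_power[OF p])
  have "[:int p:] dvd (?y ^ (p ^ n) - (Polynomial.monom 1 (p ^ n) + 1))
      - \<Psi> * (?y ^ q - (Polynomial.monom 1 q + 1))" using 2 1 by (rule dvd_diff)
  also have "\<dots> = \<Psi> * Polynomial.monom 1 q - Polynomial.monom 1 (p ^ n)"
    using eq by (simp add: algebra_simps)
  finally have "int p dvd Polynomial.coeff (\<Psi> * Polynomial.monom 1 q - Polynomial.monom 1 (p ^ n)) (i + q)"
    by (simp add: const_poly_dvd_iff)
  also have "Polynomial.coeff (\<Psi> * Polynomial.monom 1 q) (i + q) = Polynomial.coeff \<Psi> i"
    using coeff_monom_mult[of 1 q \<Psi> "i + q"] by (simp add: mult.commute)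
  hence "Polynomial.coeff (\<Psi> * Polynomial.monom 1 q - Polynomial.monom 1 (p ^ n)) (i + q)
      = Polynomial.coeff \<Psi> i - (if p ^ n = i + q then 1 else 0)" by simp
  also have "p ^ n = i + q \<longleftrightarrow> i = (p - 1) * q"
    using p2 unfolding pq[symmetric] by (auto simp: algebra_simps diff_mult_distrib)
  finally show ?thesis by (simp add: q_def)
qed

lemma prime_power_cyclotomic_lead:
  assumes p: "Factorial_Ring.prime p"
  shows "Polynomial.degree (prime_power_cyclotomic p n) = (p - 1) * p ^ (n - 1)"
    and "lead_coeff (prime_power_cyclotomic p n) = 1"
proof -
  have p2: "p \<ge> 2" using p by (rule prime_ge_2_nat)
  have coeff: "Polynomial.coeff (prime_power_cyclotomic p n) ((p - 1) * p ^ (n - 1)) = 1"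
  proof -
    have "Polynomial.coeff (prime_power_cyclotomic p n) ((p - 1) * p ^ (n - 1))
        = (\<Sum>i<p. if i = p - 1 then 1 else 0)"
      unfolding prime_power_cyclotomic_def using p2 by (auto simp: coeff_sum intro!: sum.cong)
    thus ?thesis using p2 by simp
  qed
  have "Polynomial.degree (prime_power_cyclotomic p n) \<le> (p - 1) * p ^ (n - 1)"
    unfolding prime_power_cyclotomic_def
    by (rule degree_sum_le) (auto intro!: degree_monom_le[THEN order_trans])
  thus deg: "Polynomial.degree (prime_power_cyclotomic p n) = (p - 1) * p ^ (n - 1)"
    using coeff le_degree[of "prime_power_cyclotomic p n"] by (simp add: antisym)
  show "lead_coeff (prime_power_cyclotomic p n) = 1" by (simp only: deg coeff)
qed

lemma prime_power_cyclotomic_irreducible: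
  fixes p n :: nat
  assumes p: "Factorial_Ring.prime p" and n: "n > 0"
    and AB: "prime_power_cyclotomic p n = A * B"
  shows "Polynomial.degree A = 0 \<or> Polynomial.degree B = 0"
proof -
  let ?s = "\<lambda>P. pcompose P [:1, 1 :: int:]"
  have deg: "Polynomial.degree (?s P) = Polynomial.degree P" for P
    by (simp add: degree_pcompose)
  have \<Psi>: "?s A * ?s B = ?s (prime_power_cyclotomic p n)" by (simp add: AB pcompose_mult)
  have p2: "p \<ge> 2" using p by (rule prime_ge_2_nat)
  have "Polynomial.degree (?s A) = 0 \<or> Polynomial.degree (?s B) = 0"
  proof (rule eisenstein_criterion[of "int p"])
    show "Factorial_Ring.prime (int p)" using p by simp
  next
    fix i assume "i < Polynomial.degree (?s A * ?s B)"
    hence "i < (p - 1) * p ^ (n - 1)"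
      unfolding \<Psi> deg by (simp add: prime_power_cyclotomic_lead[OF p])
    thus "int p dvd Polynomial.coeff (?s A * ?s B) i"
      using prime_power_cyclotomic_shift_coeffs[OF p n, of i] unfolding \<Psi> by simp
  next
    have "lead_coeff (?s (prime_power_cyclotomic p n)) = 1"
      using lead_coeff_comp[of "[:1, 1 :: int:]" "prime_power_cyclotomic p n"]
        prime_power_cyclotomic_lead(2)[OF p, of n] by simp
    thus "\<not> int p dvd lead_coeff (?s A * ?s B)" unfolding \<Psi> using p2 by simp
  next
    have "Polynomial.coeff (?s A * ?s B) 0 = poly (prime_power_cyclotomic p n) 1"
      unfolding \<Psi> by (simp add: poly_0_coeff_0[symmetric] poly_pcompose)
    also have "\<dots> = int p" by (simp add: prime_power_cyclotomic_def poly_sum poly_monom)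
    finally show "\<not> (int p)\<^sup>2 dvd Polynomial.coeff (?s A * ?s B) 0"
      using p2 by (simp add: power2_eq_square)
  qed
  thus ?thesis by (simp only: deg)
qed

section \<open>Complex roots of unity\<close>

lemma primitive_root_power_eq_1_iff:
  assumes "primitive_root_of_unity m z"
  shows "z ^ k = 1 \<longleftrightarrow> m dvd k"
proof
  assume "z ^ k = 1"
  have "z ^ k = z ^ (m * (k div m) + k mod m)" by simp
  also have "\<dots> = z ^ (k mod m)"
    using assms by (simp only: power_add power_mult primitive_root_of_unity_def power_one mult_1)
  finally have "z ^ (k mod m) = 1" using \<open>z ^ k = 1\<close> by simp
  hence "k mod m = 0"
    using assms by (metis primitive_root_of_unity_def mod_less_divisor not_gr_zero)
  thus "m dvd k" by (simp add: mod_eq_0_iff_dvd)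
next
  assume "m dvd k"
  thus "z ^ k = 1" using assms by (auto simp: primitive_root_of_unity_def power_mult)
qed

lemma primitive_root_powers_inj:
  assumes z: "primitive_root_of_unity m z"
  shows "inj_on (\<lambda>j. z ^ j) {..<m}"
proof (rule linorder_inj_onI)
  have nz: "z \<noteq> 0" using z by (auto simp: primitive_root_of_unity_def power_0_left)
  fix i j assume ij: "i < j" "i \<in> {..<m}" "j \<in> {..<m}"
  show "z ^ i \<noteq> z ^ j"
  proof
    assume "z ^ i = z ^ j"
    also have "z ^ j = z ^ i * z ^ (j - i)" using ij by (simp add: power_add[symmetric])
    finally have "z ^ (j - i) = 1" using nz by simp
    hence "m dvd j - i" by (simp add: primitive_root_power_eq_1_iff[OF z])
    thus False using ij by (auto dest: dvd_imp_le)
  qed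
qed auto

lemma prime_power_cyclotomic_root:
  assumes p: "Factorial_Ring.prime p" and n: "n > 0"
    and z: "primitive_root_of_unity (p ^ n) z" and j: "\<not> p dvd j"
  shows "int_poly_eval (prime_power_cyclotomic p n) (z ^ j) = 0"
proof -
  define w where "w = z ^ (j * p ^ (n - 1))"
  have "p ^ n = p * p ^ (n - 1)" using n by (simp add: power_eq_if)
  hence "w \<noteq> 1" "w ^ p = 1"
    using j prime_gt_0_nat[OF p] unfolding w_def power_mult[symmetric]
    by (simp_all add: primitive_root_power_eq_1_iff[OF z] mult_ac)
  have "int_poly_eval (prime_power_cyclotomic p n) (z ^ j) = (\<Sum>i<p. w ^ i)"
    unfolding prime_power_cyclotomic_def w_def
    by (simp add: int_poly_eval_sum int_poly_eval_monom power_mult[symmetric] mult_ac)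
  thus ?thesis using power_diff_1_eq[of w p] \<open>w \<noteq> 1\<close> \<open>w ^ p = 1\<close> by simp
qed

text \<open>
  Galois conjugacy of the primitive \<open>p ^ n\<close>-th roots of unity, without field automorphisms: they are roots of the
  same irreducible integer polynomial, so an integer polynomial that vanishes at one vanishes at all.
\<close>

lemma int_poly_eval_conjugate_root:
  assumes p: "Factorial_Ring.prime p" and n: "n > 0"
    and z: "primitive_root_of_unity (p ^ n) z" and j: "\<not> p dvd j"
    and F: "int_poly_eval F z = 0"
  shows "int_poly_eval F (z ^ j) = 0"
proof -
  have "\<not> p dvd 1" using p by (metis not_prime_unit)
  from prime_power_cyclotomic_root[OF p n z this]
  have "prime_power_cyclotomic p n dvd F"
    using prime_power_cyclotomic_irreducible[OF p n] prime_power_cyclotomic_lead(2)[OF p] F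
    by (intro irreducible_monic_dvd_of_common_root) simp_all
  thus ?thesis using prime_power_cyclotomic_root[OF p n z j]
    by (auto simp: int_poly_eval_mult)
qed

lemma root_of_unity_pow_cong:
  fixes z :: complex
  assumes z: "z ^ m = 1" and ab: "[a = b] (mod m)"
  shows "z ^ a = z ^ b"
proof -
  have red: "z ^ k = z ^ (k mod m)" for k
  proof -
    have "z ^ k = z ^ (m * (k div m) + k mod m)" by simp
    also have "\<dots> = z ^ (k mod m)" using z by (simp only: power_add power_mult power_one mult_1)
    finally show ?thesis .
  qed
  show ?thesis using red[of a] red[of b] ab by (simp add: Cong.cong_def)
qed

lemma root_of_unity_coprime_pow_eq_1:
  fixes z :: complex
  assumes z: "z ^ m = 1" and s: "coprime s m" and zs: "z ^ s = 1"
  shows "z = 1"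
proof -
  obtain s' where "[s * s' = 1] (mod m)" using cong_solve_coprime_nat[OF s] by auto
  hence "z ^ (s * s') = z ^ 1" by (rule root_of_unity_pow_cong[OF z])
  thus ?thesis using zs by (simp add: power_mult)
qed

text \<open>
  Both sides are monic polynomials of degree \<open>k\<close> in \<open>x\<close>, so their difference has degree below \<open>k\<close>, while it vanishes
  at the \<open>k\<close> powers of \<open>w\<close>.
\<close>

lemma prod_minus_roots_of_unity:
  assumes w: "primitive_root_of_unity k w"
  shows "(\<Prod>j<k. x - w ^ j) = x ^ k - 1"
proof -
  have k: "k > 0" and wk: "w ^ k = 1" using w by (simp_all add: primitive_root_of_unity_def)
  define A :: "complex poly" where "A = (\<Prod>j<k. [:- (w ^ j), 1:])"
  define B :: "complex poly" where "B = Polynomial.monom 1 k - 1"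
  have degA: "Polynomial.degree A = k"
    unfolding A_def by (simp add: degree_prod_eq_sum_degree)
  have leadA: "lead_coeff A = 1" unfolding A_def lead_coeff_prod by simp
  have "A - B = 0"
  proof (rule ccontr)
    assume nz': "A - B \<noteq> 0"
    have "Polynomial.coeff A k = 1" using degA leadA by simp
    hence c: "Polynomial.coeff (A - B) k = 0" using k by (simp add: B_def)
    have le: "Polynomial.degree (A - B) \<le> k"
      using degA unfolding B_def
      by (intro degree_diff_le) (auto intro!: degree_diff_le degree_monom_le)
    have "Polynomial.degree (A - B) \<noteq> k" using c nz' leading_coeff_0_iff by metis
    with le have deg: "Polynomial.degree (A - B) < k" by simp
    have "(\<lambda>j. w ^ j) ` {..<k} \<subseteq> {y. poly (A - B) y = 0}"
    proof clarsimp
      fix j assume "j < k"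
      hence "poly A (w ^ j) = 0" by (auto simp: A_def poly_prod)
      moreover have "poly B (w ^ j) = 0"
        using wk by (simp add: B_def poly_monom power_mult[symmetric] mult.commute[of j])
          (simp add: power_mult)
      ultimately show "poly A (w ^ j) = poly B (w ^ j)" by simp
    qed
    hence "card ((\<lambda>j. w ^ j) ` {..<k}) \<le> card {y. poly (A - B) y = 0}"
      by (intro card_mono poly_roots_finite nz')
    also have "\<dots> \<le> Polynomial.degree (A - B)" by (rule card_poly_roots_bound[OF nz'])
    finally show False using deg by (simp add: card_image[OF primitive_root_powers_inj[OF w]])
  qed
  hence "poly A x = poly B x" by simp
  thus ?thesis by (simp add: A_def B_def poly_prod poly_monom)
qed

lemma prod_roots_of_unity:
  assumes w: "primitive_root_of_unity k w"
  shows "(\<Prod>j<k. w ^ j) = (- 1) ^ (k + 1)"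
proof -
  have k: "k > 0" using w by (simp add: primitive_root_of_unity_def)
  have "(\<Prod>j<k. - (w ^ j)) = - 1" using prod_minus_roots_of_unity[OF w, of 0] k by (simp add: power_0_left)
  hence "(- 1) ^ k * (\<Prod>j<k. w ^ j) = - 1" by (simp add: prod_uminus)
  hence "(- 1) ^ k * ((- 1) ^ k * (\<Prod>j<k. w ^ j)) = - ((- 1) ^ k)" by simp
  thus ?thesis by (simp add: mult.assoc[symmetric] power_mult_distrib[symmetric])
qed

lemma prod_mult_roots_of_unity_minus_1:
  assumes w: "primitive_root_of_unity k w"
  shows "(\<Prod>j<k. x * w ^ j - 1) = (- 1) ^ (k + 1) * (x ^ k - 1)"
proof (cases "x = 0")
  case True
  have "k > 0" using w by (simp add: primitive_root_of_unity_def)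
  thus ?thesis using True by (simp add: power_0_left)
next
  case False
  have "(\<Prod>j<k. x * w ^ j - 1) = (\<Prod>j<k. - x * (inverse x - w ^ j))"
    using False by (intro prod.cong) (auto simp: field_simps)
  also have "\<dots> = (- x) ^ k * (inverse x ^ k - 1)"
    by (simp only: prod.distrib prod_constant card_lessThan prod_minus_roots_of_unity[OF w])
  also have "\<dots> = (- 1) ^ (k + 1) * (x ^ k - 1)"
    using False by (simp add: power_minus[of x] field_simps power_inverse)
  finally show ?thesis .
qed

lemma primitive_root_power_coprime:
  assumes w: "primitive_root_of_unity k w" and s: "coprime s k"
  shows "primitive_root_of_unity k (w ^ s)"
proof -
  have "(w ^ s) ^ j = 1 \<longleftrightarrow> k dvd j" for j
    using s by (simp add: power_mult[symmetric] primitive_root_power_eq_1_iff[OF w]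
      coprime_commute coprime_dvd_mult_right_iff)
  thus ?thesis using w by (auto simp: primitive_root_of_unity_def dest: dvd_imp_le)
qed

section \<open>Cyclotomic quotients\<close>

text \<open>
  The common value of \<open>\<vartheta>\<^sub>i\<close> at \<open>z\<close> and of \<open>h\<^sub>i\<close> for \<open>z\<close> in place of \<open>\<theta>\<close>, with the geometric sums summed up.
\<close>

definition cyclotomic_quotient :: "nat \<Rightarrow> nat \<Rightarrow> complex \<Rightarrow> complex" where
  "cyclotomic_quotient t i z = (z - 1) * (z ^ (t ^ Suc i) - 1) / ((z ^ t - 1) * (z ^ (t ^ i) - 1))"

text \<open>
  For \<open>s\<close> prime to \<open>k\<close> also \<open>w ^ s\<close> is a primitive \<open>k\<close>-th root of unity, so each of the four factors
  \<open>z ^ s - 1\<close> goes to \<open>z ^ (s * k) - 1\<close> up to the sign \<open>c\<close>. The two signs above the fraction bar cancel the two below it.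
\<close>

lemma cyclotomic_quotient_norm:
  assumes w: "primitive_root_of_unity k w" and t: "coprime t k"
  shows "(\<Prod>j<k. cyclotomic_quotient t i (z * w ^ j)) = cyclotomic_quotient t i (z ^ k)"
proof -
  define c :: complex where "c = (- 1) ^ (k + 1)"
  have c: "c \<noteq> 0" by (simp add: c_def)
  have fac: "(\<Prod>j<k. (z * w ^ j) ^ s - 1) = c * ((z ^ k) ^ s - 1)" if s: "coprime s k" for s
  proof -
    have "(\<Prod>j<k. (z * w ^ j) ^ s - 1) = (\<Prod>j<k. z ^ s * (w ^ s) ^ j - 1)"
      by (simp add: power_mult_distrib power_mult[symmetric] mult.commute)
    also have "\<dots> = c * ((z ^ s) ^ k - 1)"
      unfolding c_def by (rule prod_mult_roots_of_unity_minus_1[OF primitive_root_power_coprime[OF w s]])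
    finally show ?thesis by (simp add: power_mult[symmetric] mult.commute)
  qed
  have "(\<Prod>j<k. cyclotomic_quotient t i (z * w ^ j))
      = ((\<Prod>j<k. (z * w ^ j) ^ 1 - 1) * (\<Prod>j<k. (z * w ^ j) ^ (t ^ Suc i) - 1))
        / ((\<Prod>j<k. (z * w ^ j) ^ t - 1) * (\<Prod>j<k. (z * w ^ j) ^ (t ^ i) - 1))"
    unfolding cyclotomic_quotient_def by (simp only: prod_dividef prod.distrib power_one_right)
  also have "\<dots> = (c * ((z ^ k) ^ 1 - 1) * (c * ((z ^ k) ^ (t ^ Suc i) - 1)))
        / (c * ((z ^ k) ^ t - 1) * (c * ((z ^ k) ^ (t ^ i) - 1)))"
    using t by (simp only: fac coprime_power_left_iff coprime_1_left) (simp add: fac t)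
  also have "\<dots> = cyclotomic_quotient t i (z ^ k)"
    using c unfolding cyclotomic_quotient_def by (simp add: mult_ac)
  finally show ?thesis .
qed

text \<open>
  On the unit circle \<open>cnj (z ^ s - 1) = - (z ^ s - 1) / z ^ s\<close>, so the quotient differs from its conjugate by the power
  of \<open>z\<close> with exponent \<open>1 + t ^ (i+1) - t - t ^ i = (t - 1) (t ^ i - 1)\<close>. What matters for \<open>p = 2\<close> is that
  this exponent is divisible by \<open>4\<close> for odd \<open>t\<close>.
\<close>

lemma cyclotomic_quotient_cnj:
  assumes z: "cnj z = inverse z" "z \<noteq> 0" and t: "t > 0"
  shows "cyclotomic_quotient t i z = z ^ ((t - 1) * (t ^ i - 1)) * cnj (cyclotomic_quotient t i z)"
proof -
  have conj: "cnj (z ^ s - 1) = - ((z ^ s - 1) / z ^ s)" for s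
  proof -
    have "cnj (z ^ s) = inverse (z ^ s)" by (simp add: z(1) power_inverse)
    moreover have "z ^ s \<noteq> 0" using z(2) by simp
    ultimately show ?thesis by (simp add: field_simps del: complex_cnj_power)
  qed
  have "cnj (cyclotomic_quotient t i z)
      = cnj (z ^ 1 - 1) * cnj (z ^ (t ^ Suc i) - 1) / (cnj (z ^ t - 1) * cnj (z ^ (t ^ i) - 1))"
    by (simp add: cyclotomic_quotient_def)
  also have "\<dots> = cyclotomic_quotient t i z * (z ^ t * z ^ (t ^ i) / (z ^ 1 * z ^ (t ^ Suc i)))"
    unfolding conj cyclotomic_quotient_def using z by (simp add: divide_simps)
  finally have eq: "cnj (cyclotomic_quotient t i z)
      = cyclotomic_quotient t i z * (z ^ t * z ^ (t ^ i) / (z ^ 1 * z ^ (t ^ Suc i)))" .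
  have "(t - 1) * (t ^ i - 1) + (t + t ^ i) = 1 + t ^ Suc i"
  proof -
    obtain a where "t = Suc a" using t by (cases t) auto
    moreover obtain b where "t ^ i = Suc b" using t by (cases "t ^ i") auto
    ultimately show ?thesis by simp
  qed
  hence "z ^ ((t - 1) * (t ^ i - 1)) * (z ^ t * z ^ (t ^ i)) = z ^ 1 * z ^ (t ^ Suc i)"
    by (simp only: power_add[symmetric])
  thus ?thesis unfolding eq using z(2) by (simp add: field_simps)
qed

text \<open>
  The exponent \<open>r\<close> inverts \<open>t\<close>, so the sum of \<open>r\<close> powers of \<open>z ^ t\<close> is \<open>(z - 1) / (z ^ t - 1)\<close>. The second
  identity shows that the inverse is again a product of such sums; it yields the inverse of a Hoechsmann unit
  in the group ring.
\<close>

lemma cyclotomic_quotient_eq_geometric_sums: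
  assumes zm: "z ^ m = 1" and z1: "z \<noteq> 1" and t: "coprime t m" and r: "[t * r = 1] (mod m)"
  shows "(\<Sum>j<r. (z ^ t) ^ j) * (\<Sum>j<t. (z ^ (t ^ i)) ^ j) = cyclotomic_quotient t i z"
    and "(\<Sum>j<t. z ^ j) * (\<Sum>j<r. (z ^ (t ^ Suc i)) ^ j) = inverse (cyclotomic_quotient t i z)"
    and "cyclotomic_quotient t i z \<noteq> 0"
proof -
  have ne: "z ^ s \<noteq> 1" if "coprime s m" for s
    using root_of_unity_coprime_pow_eq_1[OF zm that] z1 by blast
  have ne': "z ^ t \<noteq> 1" "z ^ (t ^ i) \<noteq> 1" "z ^ (t ^ Suc i) \<noteq> 1"
    using ne t by (simp_all del: power_Suc)
  have "(z ^ t) ^ r = z ^ 1"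
    unfolding power_mult[symmetric] by (rule root_of_unity_pow_cong[OF zm r])
  hence 1: "(z ^ t) ^ r = z" by simp
  have "(z ^ (t ^ i)) ^ t = z ^ (t ^ Suc i)" by (simp add: power_mult[symmetric] mult.commute)
  with 1 show "(\<Sum>j<r. (z ^ t) ^ j) * (\<Sum>j<t. (z ^ (t ^ i)) ^ j) = cyclotomic_quotient t i z"
    by (simp add: geometric_sum ne' cyclotomic_quotient_def)
  have "(z ^ (t ^ Suc i)) ^ r = ((z ^ t) ^ r) ^ (t ^ i)"
    by (simp add: power_mult[symmetric] mult_ac)
  hence "(z ^ (t ^ Suc i)) ^ r = z ^ (t ^ i)" by (simp only: 1)
  thus "(\<Sum>j<t. z ^ j) * (\<Sum>j<r. (z ^ (t ^ Suc i)) ^ j) = inverse (cyclotomic_quotient t i z)"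
    unfolding geometric_sum[OF z1] geometric_sum[OF ne'(3)] by (simp add: cyclotomic_quotient_def)
  show "cyclotomic_quotient t i z \<noteq> 0"
    using ne' z1 by (simp add: cyclotomic_quotient_def)
qed

lemma cyc_h_eq_cyclotomic_quotient:
  assumes "z \<noteq> 1" and "z ^ (t ^ i) \<noteq> 1"
  shows "cyc_h z t i = cyclotomic_quotient t i z"
proof -
  have omega: "cyc_omega z t (int s) = (\<Sum>j<t. (z ^ s) ^ j)" for s
    unfolding cyc_omega_def of_nat_mult[symmetric] power_int_of_nat
    by (simp add: power_mult[symmetric] mult.commute)
  have "cyc_h z t i = inverse ((z ^ t - 1) / (z - 1)) * (((z ^ (t ^ i)) ^ t - 1) / (z ^ (t ^ i) - 1))"
    unfolding cyc_h_def using omega[of 1] omega[of "t ^ i"] assms by (simp add: geometric_sum)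
  thus ?thesis by (simp add: cyclotomic_quotient_def power_mult[symmetric] mult.commute[of t])
qed

section \<open>Evaluating the integral group ring of a finite cyclic group\<close>

locale finite_cyclic_group = group G for G (structure) +
  fixes g :: 'a and m :: nat
  assumes g_closed: "g \<in> carrier G"
    and g_generates: "generate G {g} = carrier G"
    and order_eq: "Coset.order G = m"
    and order_pos: "m > 0"
begin

lemma ord_generator: "ord g = m"
  using generate_pow_card[OF g_closed] by (simp add: g_generates order_eq[symmetric] Coset.order_def)

lemma generator_pow_mod: "g [^] (k mod m :: nat) = g [^] k"
proof -
  have "g [^] k = g [^] (m * (k div m) + k mod m)" by simp
  also have "\<dots> = (g [^] m) [^] (k div m) \<otimes> g [^] (k mod m)"
    using g_closed by (simp only: nat_pow_mult[symmetric] nat_pow_pow nat_pow_closed)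
  also have "g [^] m = \<one>" using pow_ord_eq_1[OF g_closed] by (simp add: ord_generator)
  finally show ?thesis using g_closed by simp
qed

lemma carrier_eq_pow_image: "carrier G = (\<lambda>j. g [^] j) ` {..<m}"
proof
  have "finite (carrier G)"
    using order_pos order_eq by (metis Coset.order_def card.infinite less_irrefl)
  hence "carrier G = {g [^] k | k. k \<in> (UNIV :: nat set)}"
    using generate_pow_on_finite_carrier[OF _ g_closed] g_generates by simp
  also have "\<dots> \<subseteq> (\<lambda>j. g [^] j) ` {..<m}"
  proof
    fix h assume "h \<in> {g [^] k | k. k \<in> (UNIV :: nat set)}"
    then obtain k :: nat where "h = g [^] k" by blast
    hence "h = g [^] (k mod m)" by (simp add: generator_pow_mod)
    thus "h \<in> (\<lambda>j. g [^] j) ` {..<m}" using order_pos by simp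
  qed
  finally show "carrier G \<subseteq> (\<lambda>j. g [^] j) ` {..<m}" .
qed (use g_closed in auto)

lemma inj_on_pow: "inj_on (\<lambda>j. g [^] (j :: nat)) {..<m}"
  by (rule eq_card_imp_inj_on)
     (simp_all add: carrier_eq_pow_image[symmetric] order_eq[unfolded Coset.order_def])

text \<open>
  Substituting \<open>z\<close> for \<open>g\<close>. For \<open>z ^ m = 1\<close> this is the linear extension to the group ring of the character of
  \<open>G\<close> that takes \<open>g\<close> to \<open>z\<close>.
\<close>

definition char_eval :: "complex \<Rightarrow> ('a \<Rightarrow>\<^sub>0 int) \<Rightarrow> complex" where
  "char_eval z x = (\<Sum>j<m. of_int (Poly_Mapping.lookup x (g [^] j)) * z ^ j)"

lemma char_eval_zero [simp]: "char_eval z 0 = 0"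
  and char_eval_add: "char_eval z (x + y) = char_eval z x + char_eval z y"
  and char_eval_diff: "char_eval z (x - y) = char_eval z x - char_eval z y"
  and char_eval_cmul: "char_eval z (frag_cmul c x) = of_int c * char_eval z x"
  by (simp_all add: char_eval_def lookup_add lookup_minus algebra_simps sum.distrib
        sum_subtractf sum_distrib_left)

lemma char_eval_sum: "char_eval z (\<Sum>i\<in>I. x i) = (\<Sum>i\<in>I. char_eval z (x i))"
  by (induction I rule: infinite_finite_induct) (simp_all add: char_eval_add)

lemma char_eval_frag_of:
  assumes "z ^ m = 1"
  shows "char_eval z (frag_of (g [^] k)) = z ^ k"
proof -
  have "char_eval z (frag_of (g [^] k)) = (\<Sum>j<m. if j = k mod m then z ^ j else 0)"
    unfolding char_eval_def generator_pow_mod[of k, symmetric] lookup_frag_of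
    using inj_on_eq_iff[OF inj_on_pow] order_pos by (intro sum.cong) simp_all
  also have "\<dots> = z ^ (k mod m)" using order_pos by simp
  also have "\<dots> = z ^ (m * (k div m) + k mod m)"
    using assms by (simp only: power_add power_mult power_one mult_1)
  finally show ?thesis by simp
qed

lemma char_eval_one: "z ^ m = 1 \<Longrightarrow> char_eval z (frag_of \<one>) = 1"
  using char_eval_frag_of[of z 0] by simp

lemma char_eval_mult:
  assumes z: "z ^ m = 1" and x: "x \<in> carrier (group_ring G)" and y: "y \<in> carrier (group_ring G)"
  shows "char_eval z (x \<otimes>\<^bsub>group_ring G\<^esub> y) = char_eval z x * char_eval z y"
proof -
  have x': "Poly_Mapping.keys x \<subseteq> carrier G" and y': "Poly_Mapping.keys y \<subseteq> carrier G"
    using x y by (simp_all add: group_ring_def)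
  have base: "char_eval z (frag_extend (\<lambda>k. frag_of (g [^] i \<otimes> k)) y) = z ^ i * char_eval z y" for i :: nat
    using y'
  proof (induction y rule: frag_induction)
    case (one k)
    then obtain j :: nat where "k = g [^] j" using carrier_eq_pow_image by auto
    thus ?case using g_closed by (simp add: char_eval_frag_of[OF z] nat_pow_mult power_add)
  qed (simp_all add: frag_extend_diff char_eval_diff right_diff_distrib)
  from x' have "char_eval z (frag_extend (\<lambda>h. frag_extend (\<lambda>k. frag_of (h \<otimes> k)) y) x)
      = char_eval z x * char_eval z y"
  proof (induction x rule: frag_induction)
    case (one h)
    then obtain i :: nat where "h = g [^] i" using carrier_eq_pow_image by auto
    thus ?case by (simp add: base char_eval_frag_of[OF z])
  qed (simp_all add: frag_extend_diff char_eval_diff left_diff_distrib)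
  thus ?thesis by (simp add: group_ring_def)
qed

lemma char_eval_1: 
  assumes "x \<in> carrier (group_ring G)"
  shows "char_eval 1 x = of_int (augmentation x)"
proof -
  have fin: "finite (carrier G)" by (simp add: carrier_eq_pow_image)
  have "char_eval 1 x = of_int (\<Sum>j<m. Poly_Mapping.lookup x (g [^] j))"
    by (simp add: char_eval_def)
  also have "(\<Sum>j<m. Poly_Mapping.lookup x (g [^] j)) = (\<Sum>h\<in>carrier G. Poly_Mapping.lookup x h)"
    unfolding carrier_eq_pow_image by (simp add: sum.reindex[OF inj_on_pow])
  also have "\<dots> = augmentation x"
    unfolding augmentation_def using assms fin
    by (intro sum.mono_neutral_right) (auto simp: group_ring_def in_keys_iff)
  finally show ?thesis .
qed

definition group_ring_poly :: "('a \<Rightarrow>\<^sub>0 int) \<Rightarrow> int poly" where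
  "group_ring_poly x = (\<Sum>j<m. Polynomial.monom (Poly_Mapping.lookup x (g [^] j)) j)"

lemma int_poly_eval_group_ring_poly: "int_poly_eval (group_ring_poly x) z = char_eval z x"
  by (simp add: group_ring_poly_def char_eval_def int_poly_eval_sum int_poly_eval_monom)

text \<open>
  The values at all \<open>m\<close>-th roots of unity form the discrete Fourier transform of \<open>x\<close>: two elements with the same
  values differ by a polynomial in \<open>g\<close> of degree less than \<open>m\<close> that has \<open>m\<close> roots.
\<close>

lemma char_eval_joint_injective:
  assumes z: "primitive_root_of_unity m z"
    and x: "x \<in> carrier (group_ring G)" and y: "y \<in> carrier (group_ring G)"
    and eq: "\<And>j. j < m \<Longrightarrow> char_eval (z ^ j) x = char_eval (z ^ j) y"
  shows "x = y"
proof -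
  define P :: "complex poly" where "P = map_poly of_int (group_ring_poly (x - y))"
  have coeff: "Polynomial.coeff (group_ring_poly (x - y)) j = Poly_Mapping.lookup (x - y) (g [^] j)" if "j < m" for j
    using that by (simp add: group_ring_poly_def coeff_sum)
  have "P = 0"
  proof (rule ccontr)
    assume P: "P \<noteq> 0"
    have root: "(\<lambda>j. z ^ j) ` {..<m} \<subseteq> {w. poly P w = 0}"
      using eq by (auto simp: P_def int_poly_eval_group_ring_poly char_eval_diff)
    have "m = card ((\<lambda>j. z ^ j) ` {..<m})"
      using primitive_root_powers_inj[OF z] by (simp add: card_image)
    also have "\<dots> \<le> card {w. poly P w = 0}" by (intro card_mono root poly_roots_finite P)
    also have "\<dots> \<le> Polynomial.degree P" by (rule card_poly_roots_bound[OF P])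
    also have "\<dots> \<le> Polynomial.degree (group_ring_poly (x - y))"
      unfolding P_def by (simp add: degree_map_poly)
    also have "\<dots> \<le> m - 1"
      unfolding group_ring_poly_def by (rule degree_sum_le) (auto intro!: degree_monom_le[THEN order_trans])
    finally show False using order_pos by simp
  qed
  have "Poly_Mapping.lookup x h = Poly_Mapping.lookup y h" for h
  proof (cases "h \<in> carrier G")
    case True
    then obtain j where j: "j < m" "h = g [^] j" using carrier_eq_pow_image by auto
    have "Polynomial.coeff P j = 0" using \<open>P = 0\<close> by simp
    thus ?thesis using coeff[OF j(1)] by (simp add: P_def coeff_map_poly j(2) lookup_minus)
  next
    case False
    hence "Poly_Mapping.lookup x h = 0" "Poly_Mapping.lookup y h = 0"
      using x y by (auto simp: group_ring_def in_keys_iff subset_iff)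
    thus ?thesis by simp
  qed
  thus ?thesis by (rule poly_mapping_eqI)
qed

lemma pow_in_group_ring: "frag_of (g [^] (k :: nat)) \<in> carrier (group_ring G)"
  using g_closed by (simp add: group_ring_def)

lemma group_ring_diff: 
  "x \<in> carrier (group_ring G) \<Longrightarrow> y \<in> carrier (group_ring G) \<Longrightarrow> x - y \<in> carrier (group_ring G)"
  by (auto simp: group_ring_def dest!: keys_diff[THEN subsetD])

lemma group_ring_cmul: "x \<in> carrier (group_ring G) \<Longrightarrow> frag_cmul c x \<in> carrier (group_ring G)"
  using keys_cmul[of c x] by (auto simp: group_ring_def)

lemma group_ring_sum: 
  assumes "\<And>i. i \<in> I \<Longrightarrow> x i \<in> carrier (group_ring G)"
  shows "(\<Sum>i\<in>I. x i) \<in> carrier (group_ring G)"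
  using assms keys_sum[of x I] by (fastforce simp: group_ring_def)

lemma ring_hom_eq_char_eval:
  assumes hom: "\<pi> \<in> ring_hom (group_ring G) (int_adjoin z)" and z: "\<pi> (frag_of g) = z"
    and zm: "z ^ m = 1" and x: "x \<in> carrier (group_ring G)"
  shows "\<pi> x = char_eval z x"
proof -
  interpret R: ring "group_ring G" by (rule ring_group_ring) (rule is_group)
  have add: "\<pi> (a + b) = \<pi> a + \<pi> b"
    if "a \<in> carrier (group_ring G)" "b \<in> carrier (group_ring G)" for a b
    using ring_hom_add[OF hom that] by (simp add: group_ring_def int_adjoin_def ring_of_type_algebra_def)
  have mult: "\<pi> (a \<otimes>\<^bsub>group_ring G\<^esub> b) = \<pi> a * \<pi> b"
    if "a \<in> carrier (group_ring G)" "b \<in> carrier (group_ring G)" for a b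
    using ring_hom_mult[OF hom that] by (simp add: int_adjoin_def ring_of_type_algebra_def)
  have zero: "\<pi> 0 = 0" using add[of 0 0] by (simp add: group_ring_def)
  have one: "\<pi> (frag_of \<one>) = 1"
    using ring_hom_one[OF hom] by (simp add: int_adjoin_def ring_of_type_algebra_def group_ring_def)
  have pow: "\<pi> (frag_of (g [^] k)) = z ^ k" for k :: nat
  proof (induction k)
    case (Suc k)
    have "frag_of (g [^] Suc k) = frag_of (g [^] k) \<otimes>\<^bsub>group_ring G\<^esub> frag_of g"
      by (simp add: group_ring_def)
    thus ?case using Suc mult[OF pow_in_group_ring[of k] pow_in_group_ring[of 1]] z g_closed
      by (simp add: mult.commute)
  qed (simp add: one)
  from x have "Poly_Mapping.keys x \<subseteq> carrier G" by (simp add: group_ring_def)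
  hence "x \<in> carrier (group_ring G) \<and> \<pi> x = char_eval z x"
  proof (induction x rule: frag_induction)
    case zero
    show ?case by (simp add: \<open>\<pi> 0 = 0\<close>) (simp add: group_ring_def)
  next
    case (one h)
    then obtain j :: nat where "h = g [^] j" using carrier_eq_pow_image by auto
    thus ?case by (simp add: pow char_eval_frag_of[OF zm] pow_in_group_ring)
  next
    case (diff a b)
    have "\<pi> (a - b) + \<pi> b = \<pi> a" using add[of "a - b" b] diff by (simp add: group_ring_diff)
    thus ?case using diff by (simp add: group_ring_diff char_eval_diff eq_diff_eq)
  qed
  thus ?thesis by simp
qed

end

section \<open>Normalized units and Hoechsmann units\<close>

context finite_cyclic_group
begin

lemma normalized_units_subgroup:
  "subgroup {u \<in> Units (group_ring G). augmentation u = 1} (units_of (group_ring G))"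
proof -
  interpret R: ring "group_ring G" by (rule ring_group_ring) (rule is_group)
  interpret U: group "units_of (group_ring G)" by (rule R.units_group)
  have mult: "augmentation (x \<otimes>\<^bsub>group_ring G\<^esub> y) = augmentation x * augmentation y"
    if "x \<in> carrier (group_ring G)" "y \<in> carrier (group_ring G)" for x y
    using char_eval_mult[of 1 x y] that by (simp add: char_eval_1 flip: of_int_mult)
  have one: "augmentation \<one>\<^bsub>group_ring G\<^esub> = 1"
    using char_eval_one[of 1] char_eval_1[OF R.one_closed] by (simp add: group_ring_def)
  show ?thesis
  proof (rule U.subgroupI)
    show "{u \<in> Units (group_ring G). augmentation u = 1} \<noteq> {}" using one by blast
    fix u assume u: "u \<in> {u \<in> Units (group_ring G). augmentation u = 1}"
    hence "augmentation u * augmentation (inv\<^bsub>group_ring G\<^esub> u) = 1"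
      using mult[of u "inv\<^bsub>group_ring G\<^esub> u"] one by (simp add: R.Units_closed)
    thus "inv\<^bsub>units_of (group_ring G)\<^esub> u \<in> {u \<in> Units (group_ring G). augmentation u = 1}"
      using u by (simp add: R.units_of_inv)
  qed (auto simp: units_of_def mult R.Units_closed)
qed

lemma normalized_units_group: "group (normalized_units G)"
proof -
  interpret R: ring "group_ring G" by (rule ring_group_ring) (rule is_group)
  show ?thesis unfolding normalized_units_def
    by (rule group.subgroup_imp_group[OF R.units_group normalized_units_subgroup])
qed

lemma normalized_units_carrier:
  "u \<in> carrier (normalized_units G) \<longleftrightarrow> u \<in> Units (group_ring G) \<and> augmentation u = 1"
  by (simp add: normalized_units_def)

lemma normalized_units_simps:
  "x \<otimes>\<^bsub>normalized_units G\<^esub> y = x \<otimes>\<^bsub>group_ring G\<^esub> y"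
  "\<one>\<^bsub>normalized_units G\<^esub> = frag_of \<one>"
  by (simp_all add: normalized_units_def units_of_def group_ring_def)

lemma normalized_units_in_group_ring:
  "u \<in> carrier (normalized_units G) \<Longrightarrow> u \<in> carrier (group_ring G)"
  by (auto simp: normalized_units_carrier Units_def)

lemma char_eval_normalized_units_hom:
  assumes z: "z ^ m = 1" and u: "u \<in> carrier (normalized_units G)" 
  shows "v \<in> carrier (normalized_units G) \<Longrightarrow>
      char_eval z (u \<otimes>\<^bsub>normalized_units G\<^esub> v) = char_eval z u * char_eval z v"
    and "char_eval z (inv\<^bsub>normalized_units G\<^esub> u) = inverse (char_eval z u)"
proof -
  interpret N: group "normalized_units G" by (rule normalized_units_group)
  show mult: "char_eval z (u \<otimes>\<^bsub>normalized_units G\<^esub> v) = char_eval z u * char_eval z v"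
    if "v \<in> carrier (normalized_units G)" for v
    using u that by (simp add: normalized_units_simps(1) char_eval_mult[OF z] normalized_units_in_group_ring)
  have "char_eval z u * char_eval z (inv\<^bsub>normalized_units G\<^esub> u) = 1"
    using mult[of "inv\<^bsub>normalized_units G\<^esub> u"] u by (simp add: normalized_units_simps(2) char_eval_one[OF z])
  thus "char_eval z (inv\<^bsub>normalized_units G\<^esub> u) = inverse (char_eval z u)"
    by (metis inverse_unique)
qed

text \<open>
  Invertibility in the group ring can be checked on values, once the inverse is known to be an
  element of the group ring.
\<close>

lemma normalized_unitI:
  assumes \<theta>: "primitive_root_of_unity m \<theta>"
    and u: "u \<in> carrier (group_ring G)" and v: "v \<in> carrier (group_ring G)"
    and inv: "\<And>z. z ^ m = 1 \<Longrightarrow> char_eval z u * char_eval z v = 1"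
    and aug: "char_eval 1 u = 1"
  shows "u \<in> carrier (normalized_units G)"
proof -
  interpret R: ring "group_ring G" by (rule ring_group_ring) (rule is_group)
  have \<theta>m: "(\<theta> ^ j) ^ m = 1" for j
    using \<theta> by (simp add: primitive_root_of_unity_def power_mult[symmetric] mult.commute[of j])
      (simp add: power_mult)
  have one: "char_eval z \<one>\<^bsub>group_ring G\<^esub> = 1" if "z ^ m = 1" for z
    using char_eval_one[OF that] by (simp add: group_ring_def)
  have "u \<otimes>\<^bsub>group_ring G\<^esub> v = \<one>\<^bsub>group_ring G\<^esub>"
    by (rule char_eval_joint_injective[OF \<theta>])
       (simp_all add: u v char_eval_mult[OF \<theta>m] one[OF \<theta>m] inv[OF \<theta>m])
  moreover have "v \<otimes>\<^bsub>group_ring G\<^esub> u = \<one>\<^bsub>group_ring G\<^esub>"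
    by (rule char_eval_joint_injective[OF \<theta>])
       (simp_all add: u v char_eval_mult[OF \<theta>m] one[OF \<theta>m] inv[OF \<theta>m] mult.commute[of "char_eval _ v"])
  ultimately have "u \<in> Units (group_ring G)" using u v unfolding Units_def by blast
  moreover have "augmentation u = 1" using aug char_eval_1[OF u] by simp
  ultimately show ?thesis by (simp add: normalized_units_carrier)
qed

lemma generator_normalized_unit: 
  assumes \<theta>: "primitive_root_of_unity m \<theta>"
  shows "frag_of g \<in> carrier (normalized_units G)"
proof (rule normalized_unitI[OF \<theta>, of _ "frag_of (g [^] (m - 1))"])
  show "frag_of g \<in> carrier (group_ring G)" "frag_of (g [^] (m - 1)) \<in> carrier (group_ring G)"
    using g_closed by (simp_all add: group_ring_def)
  have ev: "char_eval z (frag_of g) = z" if "z ^ m = 1" for z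
    using char_eval_frag_of[OF that, of 1] g_closed by simp
  show "char_eval z (frag_of g) * char_eval z (frag_of (g [^] (m - 1))) = 1" if "z ^ m = 1" for z
    using that order_pos by (simp add: ev char_eval_frag_of power_eq_if[of z m])
  show "char_eval 1 (frag_of g) = 1" by (simp add: ev)
qed

lemma char_eval_geometric_sum:
  "z ^ m = 1 \<Longrightarrow> char_eval z (\<Sum>j<a. frag_of (g [^] (j * k))) = (\<Sum>j<a. (z ^ k) ^ j)"
  by (simp add: char_eval_sum char_eval_frag_of power_mult[symmetric] mult.commute)

lemma char_eval_norm_element:
  assumes "z ^ m = 1"
  shows "char_eval z (\<Sum>j<m. frag_of (g [^] j)) = (if z = 1 then of_nat m else 0)"
  using char_eval_geometric_sum[OF assms, where a = m and k = 1] power_diff_1_eq[of z m] assms by auto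

text \<open>
  The multiple of the norm element is chosen so that the augmentation drops from \<open>a * b\<close> to \<open>1\<close>; it does not
  affect the values at \<open>z \<noteq> 1\<close>. The form with free \<open>a\<close>, \<open>b\<close>, \<open>k\<close>, \<open>l\<close> covers both the
  Hoechsmann units and their inverses.
\<close>

lemma char_eval_corrected_product:
  fixes z :: complex and a b k l t r :: nat
  assumes z: "z ^ m = 1" and t: "t > 0" and r: "[t * r = 1] (mod m)" "r > 0" and ab: "a * b = t * r"
  defines "x \<equiv> (\<Sum>j<a. frag_of (g [^] (j * k))) \<otimes>\<^bsub>group_ring G\<^esub> (\<Sum>j<b. frag_of (g [^] (j * l)))
     - frag_cmul (int ((t * r - 1) div m)) (\<Sum>j<m. frag_of (g [^] j))"
  shows "x \<in> carrier (group_ring G)"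
    and "char_eval z x = (if z = 1 then 1 else (\<Sum>j<a. (z ^ k) ^ j) * (\<Sum>j<b. (z ^ l) ^ j))"
proof -
  interpret R: ring "group_ring G" by (rule ring_group_ring) (rule is_group)
  note in_ring = group_ring_sum group_ring_cmul group_ring_diff pow_in_group_ring
  show "x \<in> carrier (group_ring G)"
    unfolding x_def by (intro in_ring R.m_closed)
  have "m dvd t * r - 1" using r t cong_altdef_nat[of 1 "t * r" m] by simp
  hence "(t * r - 1) div m * m = t * r - 1" by simp
  hence "(t * r - 1) div m * m + 1 = a * b" using t r ab by simp
  hence 1: "of_nat a * of_nat b - of_nat ((t * r - 1) div m) * of_nat m = (1 :: complex)"
    unfolding of_nat_mult[symmetric] by (metis add_diff_cancel_left' of_nat_1 of_nat_add)
  show "char_eval z x = (if z = 1 then 1 else (\<Sum>j<a. (z ^ k) ^ j) * (\<Sum>j<b. (z ^ l) ^ j))"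
    unfolding x_def char_eval_diff char_eval_cmul char_eval_norm_element[OF z]
      char_eval_mult[OF z group_ring_sum[OF pow_in_group_ring] group_ring_sum[OF pow_in_group_ring]]
      char_eval_geometric_sum[OF z]
    using 1 by simp
qed

lemma hoechsmann_unit_normalized:
  assumes \<theta>: "primitive_root_of_unity m \<theta>"
    and t: "t > 0" "coprime t m" and r: "[t * r = 1] (mod m)" "r > 0"
  shows "hoechsmann_unit G g m t r i \<in> carrier (normalized_units G)"
    and "z ^ m = 1 \<Longrightarrow> z \<noteq> 1 \<Longrightarrow>
      char_eval z (hoechsmann_unit G g m t r i) = cyclotomic_quotient t i z"
proof -
  define u where "u = hoechsmann_unit G g m t r i"
  define v where "v = (\<Sum>j<t. frag_of (g [^] (j * 1))) \<otimes>\<^bsub>group_ring G\<^esub>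
        (\<Sum>j<r. frag_of (g [^] (j * t ^ Suc i)))
     - frag_cmul (int ((t * r - 1) div m)) (\<Sum>j<m. frag_of (g [^] j))"
  have u: "u \<in> carrier (group_ring G)"
    "char_eval z u = (if z = 1 then 1 else cyclotomic_quotient t i z)" if "z ^ m = 1" for z
    using char_eval_corrected_product[OF that t(1) r, of r t t "t ^ i"]
      cyclotomic_quotient_eq_geometric_sums(1)[OF that _ t(2) r(1), of i]
    by (simp_all add: u_def hoechsmann_unit_def mult.commute)
  have v: "v \<in> carrier (group_ring G)"
    "char_eval z v = (if z = 1 then 1 else inverse (cyclotomic_quotient t i z))" if "z ^ m = 1" for z
    using char_eval_corrected_product[OF that t(1) r, of t r 1 "t ^ Suc i"]
      cyclotomic_quotient_eq_geometric_sums(2)[OF that _ t(2) r(1), of i]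
    by (simp_all del: power_Suc add: v_def)
  show "hoechsmann_unit G g m t r i \<in> carrier (normalized_units G)"
    using u(1)[of 1] v(1)[of 1] u(2) v(2)
      cyclotomic_quotient_eq_geometric_sums(3)[OF _ _ t(2) r(1), of _ i]
    unfolding u_def[symmetric] by (intro normalized_unitI[OF \<theta>, of _ v]) simp_all
  show "char_eval z (hoechsmann_unit G g m t r i) = cyclotomic_quotient t i z"
    if "z ^ m = 1" "z \<noteq> 1"
    using u(2)[OF that(1)] that(2) by (simp add: u_def)
qed

end

section \<open>Compatibility with norms between the levels\<close>

text \<open>
  For \<open>p = 2\<close> the sign of the norm relation is extracted by an exponent \<open>2 ^ n / 4\<close>, hence \<open>n \<ge> 2\<close>.
\<close>

locale cyclic_p_group = finite_cyclic_group G g "p ^ n"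
  for G (structure) and g :: 'a and p n :: nat +
  fixes \<theta> :: complex
  assumes prime_p: "Factorial_Ring.prime p"
    and n_pos: "n > 0" and n_two: "p = 2 \<Longrightarrow> n \<ge> 2"
    and primitive: "primitive_root_of_unity (p ^ n) \<theta>"
begin

text \<open>
  A primitive \<open>p\<close>-th root of unity, so that the solutions \<open>y\<close> of \<open>y ^ p = z ^ p\<close> are \<open>z * sub_root ^ j\<close> for \<open>j < p\<close>.
\<close>

definition sub_root :: complex where "sub_root = \<theta> ^ (p ^ (n - 1))"

lemma p_power_n: "p ^ n = p ^ (n - 1) * p"
  using n_pos by (simp add: power_eq_if)

lemma theta_power_root: "(\<theta> ^ j) ^ (p ^ n) = 1"
  using primitive_root_power_eq_1_iff[OF primitive] by (simp add: power_mult[symmetric])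

lemma primitive_sub_root: "primitive_root_of_unity p sub_root"
proof -
  have "sub_root ^ k = 1 \<longleftrightarrow> p dvd k" for k
    using prime_gt_0_nat[OF prime_p]
    by (simp add: sub_root_def power_mult[symmetric] primitive_root_power_eq_1_iff[OF primitive] p_power_n)
  thus ?thesis using prime_gt_0_nat[OF prime_p]
    by (auto simp: primitive_root_of_unity_def dest: dvd_imp_le)
qed

text \<open>
  For \<open>p = 2\<close> the product of the two square roots of \<open>z\<^sup>2\<close> is \<open>- z\<^sup>2\<close>, so \<open>g\<close> obeys the norm relation only up to sign.
  In a product of generators the sign depends on the parity of the exponent of \<open>g\<close>. This multiplicative
  function recovers it from the value \<open>y\<close> at \<open>\<theta>\<close>: the factor \<open>y / cnj y\<close> is \<open>\<theta>\<^sup>2\<close> for \<open>g\<close> and a power of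
  \<open>\<theta> ^ 4\<close> for a Hoechsmann unit, and raising to the power \<open>2 ^ n / 4\<close> yields \<open>-1\<close> and \<open>1\<close> respectively.
\<close>

definition norm_sign :: "complex \<Rightarrow> complex" where
  "norm_sign y = (if p = 2 then (y / cnj y) ^ (p ^ n div 4) else 1)"

lemma norm_sign_mult: "norm_sign (x * y) = norm_sign x * norm_sign y"
  by (simp add: norm_sign_def power_mult_distrib[symmetric])

lemma norm_sign_inverse: "norm_sign (inverse y) = inverse (norm_sign y)"
  by (simp add: norm_sign_def power_inverse[symmetric] divide_simps)

lemma norm_sign_1: "norm_sign 1 = 1"
  by (simp add: norm_sign_def)

lemma cnj_theta: "cnj \<theta> = inverse \<theta>" and theta_nonzero: "\<theta> \<noteq> 0"
proof -
  have "norm \<theta> ^ (p ^ n) = 1"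
    using theta_power_root[of 1] by (simp add: norm_power[symmetric])
  hence "norm \<theta> = 1" using order_pos power_eq_imp_eq_base[of "norm \<theta>" "p ^ n" 1] by simp
  hence "\<theta> * cnj \<theta> = 1" by (simp add: complex_norm_square[symmetric])
  thus "cnj \<theta> = inverse \<theta>" "\<theta> \<noteq> 0" by (auto simp: inverse_unique)
qed

lemma four_dvd: "p = 2 \<Longrightarrow> 4 dvd p ^ n"
  using n_two le_imp_power_dvd[of 2 n "2 :: nat"] by simp

lemma norm_sign_theta: "norm_sign \<theta> = (- 1) ^ (p + 1)"
proof (cases "p = 2")
  case True
  have "norm_sign \<theta> = (\<theta> ^ 2) ^ (p ^ n div 4)"
    unfolding norm_sign_def using True by (simp add: cnj_theta power2_eq_square divide_inverse)
  also have "\<dots> = \<theta> ^ (p ^ (n - 1))"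
  proof -
    have "2 * (p ^ n div 4) = p ^ (n - 1)" using four_dvd[OF True] True p_power_n by auto
    thus ?thesis by (simp add: power_mult[symmetric])
  qed
  also have "\<dots> = - 1"
  proof -
    have "sub_root ^ 2 = 1" "sub_root \<noteq> 1"
      using primitive_sub_root True
      by (auto simp: primitive_root_of_unity_def dest: spec[of _ 1])
    thus ?thesis unfolding sub_root_def by (simp add: power2_eq_1_iff)
  qed
  finally show ?thesis using True by simp
next
  case False
  hence "odd p" using prime_p primes_dvd_imp_eq two_is_prime_nat by blast
  thus ?thesis using False by (simp add: norm_sign_def)
qed

lemma norm_sign_cyclotomic_quotient:
  assumes t: "coprime t p" "t > 0" and nz: "cyclotomic_quotient t i \<theta> \<noteq> 0"
  shows "norm_sign (cyclotomic_quotient t i \<theta>) = 1"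
proof (cases "p = 2")
  case True
  hence "odd t" using t by simp
  hence "even (t - 1)" "even (t ^ i - 1)" by simp_all
  hence "2 * 2 dvd (t - 1) * (t ^ i - 1)" by (rule mult_dvd_mono)
  then obtain k where k: "(t - 1) * (t ^ i - 1) = 4 * k" by auto
  have "cyclotomic_quotient t i \<theta> = \<theta> ^ (4 * k) * cnj (cyclotomic_quotient t i \<theta>)"
    unfolding k[symmetric] by (rule cyclotomic_quotient_cnj[OF cnj_theta theta_nonzero t(2)])
  hence "cyclotomic_quotient t i \<theta> / cnj (cyclotomic_quotient t i \<theta>) = \<theta> ^ (4 * k)"
    using nz by (metis complex_cnj_zero_iff nonzero_eq_divide_eq)
  moreover have "4 * k * (p ^ n div 4) = k * p ^ n" using four_dvd[OF True] by auto
  ultimately show ?thesis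
    unfolding norm_sign_def using theta_power_root[of k] True
    by (simp only: simp_thms if_True power_mult[symmetric])
qed (simp add: norm_sign_def)

text \<open>
  For \<open>z\<close> of order \<open>p ^ k\<close> with \<open>k \<ge> 2\<close> the left-hand side is the norm of the value at level \<open>k\<close> down to level \<open>k - 1\<close>.
  The case \<open>z ^ p = 1\<close> is left out because there one of the values on the left is the augmentation, to which the
  formula for the values of a Hoechsmann unit does not apply.
\<close>

definition norm_compatible :: "('a \<Rightarrow>\<^sub>0 int) \<Rightarrow> bool" where
  "norm_compatible u \<longleftrightarrow> (\<forall>z. z ^ (p ^ n) = 1 \<and> z ^ p \<noteq> 1 \<longrightarrow>
     (\<Prod>j<p. char_eval (z * sub_root ^ j) u) = norm_sign (char_eval \<theta> u) * char_eval (z ^ p) u)"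

lemma fibre_roots:
  assumes "z ^ (p ^ n) = 1"
  shows "(z * sub_root ^ j) ^ (p ^ n) = 1" and "(z ^ p) ^ (p ^ n) = 1"
    and "(z * sub_root ^ j) ^ p = z ^ p"
proof -
  have "(sub_root ^ j) ^ p = 1"
    using primitive_sub_root
    by (simp add: primitive_root_of_unity_def power_mult[symmetric] mult.commute[of j]) (simp add: power_mult)
  thus p: "(z * sub_root ^ j) ^ p = z ^ p" by (simp add: power_mult_distrib)
  have "(z * sub_root ^ j) ^ (p ^ n) = ((z * sub_root ^ j) ^ p) ^ (p ^ (n - 1))"
    unfolding p_power_n by (simp add: power_mult[symmetric] mult.commute)
  also have "\<dots> = z ^ (p ^ n)" unfolding p p_power_n by (simp add: power_mult[symmetric] mult.commute)
  finally show "(z * sub_root ^ j) ^ (p ^ n) = 1" using assms by simp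
  show "(z ^ p) ^ (p ^ n) = 1" using assms
    by (simp add: power_mult[symmetric] mult.commute[of p]) (simp add: power_mult)
qed

lemma norm_compatible_generator: "norm_compatible (frag_of g)"
  unfolding norm_compatible_def
proof clarify
  fix z :: complex assume z: "z ^ (p ^ n) = 1"
  have ev: "char_eval y (frag_of g) = y" if "y ^ (p ^ n) = 1" for y
    using char_eval_frag_of[OF that, of 1] g_closed by simp
  have "(\<Prod>j<p. char_eval (z * sub_root ^ j) (frag_of g)) = (\<Prod>j<p. z * sub_root ^ j)"
    by (intro prod.cong refl ev fibre_roots(1)[OF z])
  also have "\<dots> = z ^ p * (- 1) ^ (p + 1)"
    by (simp only: prod.distrib prod_constant card_lessThan prod_roots_of_unity[OF primitive_sub_root])
  also have "\<dots> = norm_sign (char_eval \<theta> (frag_of g)) * char_eval (z ^ p) (frag_of g)"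
    using theta_power_root[of 1] by (simp add: ev fibre_roots(2)[OF z] norm_sign_theta)
  finally show "(\<Prod>j<p. char_eval (z * sub_root ^ j) (frag_of g))
      = norm_sign (char_eval \<theta> (frag_of g)) * char_eval (z ^ p) (frag_of g)" .
qed

lemma theta_ne_1: "\<theta> \<noteq> 1"
proof
  assume "\<theta> = 1"
  hence "p ^ n dvd 1" using primitive_root_power_eq_1_iff[OF primitive, of 1] by simp
  thus False using n_pos prime_gt_1_nat[OF prime_p] by simp
qed

lemma norm_compatible_hoechsmann:
  assumes t: "t > 0" "coprime t p" and r: "[t * r = 1] (mod (p ^ n))" "r > 0"
  shows "norm_compatible (hoechsmann_unit G g (p ^ n) t r i)"
  unfolding norm_compatible_def
proof clarify
  fix z :: complex assume z: "z ^ (p ^ n) = 1" "z ^ p \<noteq> 1"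
  have t': "coprime t (p ^ n)" using t by simp
  note ev = hoechsmann_unit_normalized(2)[OF primitive t(1) t' r]
  have ne: "z * sub_root ^ j \<noteq> 1" for j
    using fibre_roots(3)[OF z(1), of j] z(2) by auto
  have \<theta>: "\<theta> ^ (p ^ n) = 1" using theta_power_root[of 1] by simp
  have sign: "norm_sign (cyclotomic_quotient t i \<theta>) = 1"
    by (intro norm_sign_cyclotomic_quotient t cyclotomic_quotient_eq_geometric_sums(3)[OF \<theta> theta_ne_1 t' r(1)])
  show "(\<Prod>j<p. char_eval (z * sub_root ^ j) (hoechsmann_unit G g (p ^ n) t r i))
      = norm_sign (char_eval \<theta> (hoechsmann_unit G g (p ^ n) t r i))
        * char_eval (z ^ p) (hoechsmann_unit G g (p ^ n) t r i)"
    using cyclotomic_quotient_norm[OF primitive_sub_root t(2), of i z]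
    by (simp add: ev[OF fibre_roots(1)[OF z(1)] ne] ev[OF \<theta> theta_ne_1] ev[OF fibre_roots(2)[OF z(1)] z(2)] sign)
qed

lemma norm_compatible_generate:
  assumes S: "S \<subseteq> carrier (normalized_units G)" and comp: "\<And>u. u \<in> S \<Longrightarrow> norm_compatible u"
    and u: "u \<in> generate (normalized_units G) S"
  shows "norm_compatible u"
proof -
  interpret N: group "normalized_units G" by (rule normalized_units_group)
  have \<theta>: "\<theta> ^ (p ^ n) = 1" using theta_power_root[of 1] by simp
  note hom = char_eval_normalized_units_hom
  from u show ?thesis
  proof (induction rule: generate.induct)
    case one
    show ?case unfolding norm_compatible_def
      by (auto simp: normalized_units_simps char_eval_one \<theta> fibre_roots norm_sign_1)
  next
    case (incl u)
    thus ?case by (rule comp)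
  next
    case (inv u)
    hence u: "u \<in> carrier (normalized_units G)" using S by blast
    show ?case
      using comp[OF inv] unfolding norm_compatible_def
      by (auto simp: hom(2)[OF _ u] \<theta> fibre_roots norm_sign_inverse prod_inversef[unfolded o_def])
  next
    case (eng u v)
    have uv: "u \<in> carrier (normalized_units G)" "v \<in> carrier (normalized_units G)"
      using eng S N.generate_in_carrier by blast+
    show ?case
      using eng.IH unfolding norm_compatible_def
      by (auto simp: hom(1)[OF _ uv] \<theta> fibre_roots norm_sign_mult prod.distrib)
  qed
qed

text \<open>
  The value \<open>1\<close> spreads from \<open>\<theta>\<close> to the other primitive roots by conjugacy, and from the
  roots of order \<open>p ^ (n - e)\<close> to those of order \<open>p ^ (n - e - 1)\<close> by the norm relation, whose sign is trivial because it
  depends only on the value at \<open>\<theta>\<close>. The root \<open>1\<close> is not reached in this way; there the augmentation is used.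
\<close>

lemma norm_compatible_kernel_trivial:
  assumes u: "u \<in> carrier (normalized_units G)" and comp: "norm_compatible u"
    and ker: "char_eval \<theta> u = 1"
  shows "u = \<one>\<^bsub>normalized_units G\<^esub>"
proof -
  have u': "u \<in> carrier (group_ring G)" using u by (rule normalized_units_in_group_ring)
  have \<theta>: "\<theta> ^ (p ^ n) = 1" using theta_power_root[of 1] by simp
  have tower: "char_eval (\<theta> ^ (p ^ e * j)) u = 1" if "e < n" "\<not> p dvd j" for e j
    using that
  proof (induction e arbitrary: j)
    case 0
    have "int_poly_eval (group_ring_poly (u - frag_of \<one>)) \<theta> = 0"
      using ker by (simp add: int_poly_eval_group_ring_poly char_eval_diff char_eval_one[OF \<theta>])
    hence "int_poly_eval (group_ring_poly (u - frag_of \<one>)) (\<theta> ^ j) = 0"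
      by (rule int_poly_eval_conjugate_root[OF prime_p n_pos primitive 0(2)])
    thus ?case
      by (simp add: int_poly_eval_group_ring_poly char_eval_diff char_eval_one[OF theta_power_root])
  next
    case (Suc e)
    define z where "z = \<theta> ^ (p ^ e * j)"
    have z: "z ^ (p ^ n) = 1" unfolding z_def by (rule theta_power_root)
    have zp: "z ^ p = \<theta> ^ (p ^ Suc e * j)" unfolding z_def by (simp add: power_mult[symmetric] mult_ac)
    have "\<not> p ^ n dvd p ^ Suc e * j"
    proof
      assume "p ^ n dvd p ^ Suc e * j"
      moreover have "p ^ n = p ^ Suc e * p ^ (n - Suc e)"
        using Suc.prems by (simp only: power_add[symmetric]) simp
      ultimately have "p ^ (n - Suc e) dvd j"
        using prime_gt_0_nat[OF prime_p] by simp
      moreover have "p dvd p ^ (n - Suc e)" using Suc.prems by (intro dvd_power) simp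
      ultimately show False using Suc.prems(2) dvd_trans by blast
    qed
    hence "z ^ p \<noteq> 1" unfolding zp by (simp only: primitive_root_power_eq_1_iff[OF primitive] not_False_eq_True)
    hence "(\<Prod>j<p. char_eval (z * sub_root ^ j) u) = char_eval (z ^ p) u"
      using comp z unfolding norm_compatible_def by (simp add: ker norm_sign_1)
    \<comment> \<open>All \<open>p\<close>-th roots of \<open>z ^ p\<close> have the same order as \<open>z\<close>, so the induction hypothesis applies to them.\<close>
    moreover have "char_eval (z * sub_root ^ i) u = 1" for i
    proof -
      have "p ^ (n - 1) = p ^ e * p ^ (n - 1 - e)"
        using Suc.prems by (simp add: power_add[symmetric])
      hence "z * sub_root ^ i = \<theta> ^ (p ^ e * (j + i * p ^ (n - 1 - e)))"
        unfolding z_def sub_root_def by (simp add: power_mult[symmetric] power_add[symmetric] algebra_simps)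
      moreover have "p dvd i * p ^ (n - 1 - e)" using Suc.prems by (intro dvd_mult dvd_power) simp
      hence "\<not> p dvd j + i * p ^ (n - 1 - e)" using Suc.prems(2) dvd_add_left_iff by blast
      ultimately show ?thesis using Suc.IH Suc.prems by simp
    qed
    ultimately show ?case by (simp add: zp)
  qed
  have "u = frag_of \<one>"
  proof (rule char_eval_joint_injective[OF primitive u'])
    show "frag_of \<one> \<in> carrier (group_ring G)" using pow_in_group_ring[of 0] by simp
    fix k assume k: "k < p ^ n"
    have "char_eval (\<theta> ^ k) u = 1"
    proof (cases "k = 0")
      case True
      thus ?thesis using u by (simp add: char_eval_1[OF u'] normalized_units_carrier)
    next
      case False
      then obtain j where j: "k = p ^ multiplicity p k * j" "\<not> p dvd j"
        using multiplicity_decompose'[of k p] prime_p by (metis not_prime_unit)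
      have "p ^ multiplicity p k \<le> k" using False by (intro dvd_imp_le multiplicity_dvd) simp
      hence "p ^ multiplicity p k < p ^ n" using k by simp
      hence "multiplicity p k < n" using prime_gt_1_nat[OF prime_p] by simp
      thus ?thesis using tower[OF _ j(2)] j(1) by metis
    qed
    thus "char_eval (\<theta> ^ k) u = char_eval (\<theta> ^ k) (frag_of \<one>)"
      by (simp add: char_eval_one[OF theta_power_root])
  qed
  thus ?thesis by (simp add: normalized_units_simps)
qed

end

section \<open>The isomorphism\<close>

lemma ring_int_adjoin: "ring (int_adjoin z)"
proof -
  interpret C: ring "ring_of_type_algebra :: complex ring" by (rule ring_from_type_algebra)
  show ?thesis unfolding int_adjoin_def
    by (rule C.generate_ring_is_ring) (simp add: ring_of_type_algebra_def)
qed

lemma ring_hom_units: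
  assumes R: "ring R" and S: "ring S" and h: "h \<in> ring_hom R S" and x: "x \<in> Units R"
  shows "h x \<in> Units S"
proof -
  interpret R: ring R by fact
  have "inv\<^bsub>R\<^esub> x \<in> carrier R" "x \<in> carrier R"
    "inv\<^bsub>R\<^esub> x \<otimes>\<^bsub>R\<^esub> x = \<one>\<^bsub>R\<^esub>" "x \<otimes>\<^bsub>R\<^esub> inv\<^bsub>R\<^esub> x = \<one>\<^bsub>R\<^esub>"
    using x by (simp_all add: R.Units_closed)
  thus ?thesis unfolding Units_def
    using ring_hom_closed[OF h] ring_hom_mult[OF h] ring_hom_one[OF h]
    by (auto intro!: bexI[of _ "h (inv\<^bsub>R\<^esub> x)"]) metis+
qed

theorem theorem8:
  fixes p n t r \<kappa> :: nat
    and \<theta> :: complex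
    and G :: "('a, 'b) monoid_scheme"
    and g :: 'a
    and \<pi>\<^sub>1 :: "('a \<Rightarrow>\<^sub>0 int) \<Rightarrow> complex"
    and S :: "('a \<Rightarrow>\<^sub>0 int) set"
    and U\<^sub>0 :: "complex set"
  assumes "Factorial_Ring.prime p"
    and "odd p \<Longrightarrow> n \<ge> 2"
    and "p = 2 \<Longrightarrow> n \<ge> 3"
    and "primitive_root_of_unity (p ^ n) \<theta>"
    and "group G" and "Coset.order G = p ^ n"
    and "g \<in> carrier G" and "generate G {g} = carrier G"
    and "\<kappa> = totient (p ^ n) div 2 - 1"
    and "t > 0"
    and "odd p \<Longrightarrow>
           int t mod int (p ^ n) \<in> Units (residue_ring (int (p ^ n))) \<and>
           generate (units_of (residue_ring (int (p ^ n)))) {int t mod int (p ^ n)}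
             = Units (residue_ring (int (p ^ n)))"
    and "p = 2 \<Longrightarrow> t = 3"
    and "generate (units_of (int_adjoin \<theta>))
           ({-1, \<theta>} \<union> {cyc_mu \<theta> i | i. 1 < i \<and> real i < real (p ^ n) / 2 \<and> gcd i (p ^ n) = 1})
           = Units (int_adjoin \<theta>)"
    and "\<pi>\<^sub>1 \<in> ring_hom (group_ring G) (int_adjoin \<theta>)" and "\<pi>\<^sub>1 (frag_of g) = \<theta>"
    and "(-1) ^ p * cyc_mu \<theta> t ^ (totient (p ^ n) div (2 * p))
           \<notin> \<pi>\<^sub>1 ` carrier (normalized_units G)"
    and "r = (LEAST r. 0 < r \<and> [t * r = 1] (mod p ^ n))"
    and "S = {frag_of g} \<union> hoechsmann_unit G g (p ^ n) t r ` {1..\<kappa>}"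
    and "U\<^sub>0 = {\<theta>} \<union> cyc_h \<theta> t ` {1..\<kappa>}"
  shows "(normalized_units G)\<lparr>carrier := generate (normalized_units G) S\<rparr>
         \<cong> (units_of (int_adjoin \<theta>))\<lparr>carrier := generate (units_of (int_adjoin \<theta>)) U\<^sub>0\<rparr>"
proof -
  note prime = assms(1) and n_odd = assms(2) and n_even = assms(3) and primitive = assms(4)
    and G_group = assms(5) and G_order = assms(6) and g = assms(7,8) and t_pos = assms(10)
    and t_odd = assms(11) and t_even = assms(12) and hom = assms(14) and \<pi>_g = assms(15)
    and r_def = assms(17) and S_def = assms(18) and U_def = assms(19)
  have p_cases: "p = 2 \<or> odd p" using prime primes_dvd_imp_eq two_is_prime_nat by blast
  have n: "n > 0" using n_odd n_even p_cases by auto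
  interpret G: group G by fact
  interpret cyclic_p_group G g p n \<theta>
  proof unfold_locales
    show "0 < p ^ n" using prime by (simp add: prime_gt_0_nat)
  qed (use prime n n_even primitive G_order g in auto)
  interpret R: ring "group_ring G" by (rule ring_group_ring) (rule G_group)
  interpret Z: ring "int_adjoin \<theta>" by (rule ring_int_adjoin)
  interpret N: group "normalized_units G" by (rule normalized_units_group)
  interpret U: group "units_of (int_adjoin \<theta>)" by (rule Z.units_group)

  have pn1: "1 < p ^ n" using n prime_gt_1_nat[OF prime] by (rule one_less_power[rotated])
  have tp: "coprime t p"
  proof (cases "p = 2")
    case True
    thus ?thesis using t_even by simp
  next
    case False
    hence unit: "int t mod int (p ^ n) \<in> Units (residue_ring (int (p ^ n)))"
      using p_cases t_odd by blast
    have "1 < int (p ^ n)" using pn1 by (metis of_nat_1 of_nat_less_iff)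
    hence res: "residues (int (p ^ n))" by (rule residues.intro)
    have "coprime (int t mod int (p ^ n)) (int (p ^ n))"
      using unit unfolding residues.res_units_eq[OF res] by simp
    hence "coprime (int t) (int (p ^ n))"
      using order_pos by (subst (asm) coprime_mod_left_iff) simp_all
    hence "coprime t (p ^ n)" by (simp only: coprime_int_iff)
    thus ?thesis using n by simp
  qed
  hence tpn: "coprime t (p ^ n)" by simp
  obtain s where s: "[t * s = 1] (mod p ^ n)" using cong_solve_coprime_nat[OF tpn] by auto
  have "s > 0" using s pn1 by (cases "s = 0") (auto simp: Cong.cong_def)
  hence "0 < s \<and> [t * s = 1] (mod p ^ n)" using s by (rule conjI)
  hence r: "0 < r \<and> [t * r = 1] (mod p ^ n)" unfolding r_def by (rule LeastI)
  hence r': "[t * r = 1] (mod p ^ n)" "r > 0" by simp_all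

  have \<theta>: "\<theta> ^ (p ^ n) = 1" using theta_power_root[of 1] by simp
  have \<pi>: "\<pi>\<^sub>1 x = char_eval \<theta> x" if "x \<in> carrier (group_ring G)" for x
    by (rule ring_hom_eq_char_eval[OF hom \<pi>_g \<theta> that])
  have S: "S \<subseteq> carrier (normalized_units G)"
    using generator_normalized_unit[OF primitive]
      hoechsmann_unit_normalized(1)[OF primitive t_pos tpn r']
    by (auto simp: S_def)
  have comp: "norm_compatible u" if "u \<in> S" for u
    using that norm_compatible_generator norm_compatible_hoechsmann[OF t_pos tp r']
    by (auto simp: S_def)

  have \<pi>_hom: "\<pi>\<^sub>1 \<in> hom (normalized_units G) (units_of (int_adjoin \<theta>))"
  proof (rule homI)
    fix u assume u: "u \<in> carrier (normalized_units G)"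
    thus "\<pi>\<^sub>1 u \<in> carrier (units_of (int_adjoin \<theta>))"
      using ring_hom_units[OF R.ring_axioms Z.ring_axioms hom]
      by (simp add: normalized_units_carrier units_of_carrier)
    fix v assume "v \<in> carrier (normalized_units G)"
    thus "\<pi>\<^sub>1 (u \<otimes>\<^bsub>normalized_units G\<^esub> v) = \<pi>\<^sub>1 u \<otimes>\<^bsub>units_of (int_adjoin \<theta>)\<^esub> \<pi>\<^sub>1 v"
      using ring_hom_mult[OF hom, of u v] u
      by (simp add: normalized_units_simps units_of_mult normalized_units_in_group_ring)
  qed
  interpret \<pi>: group_hom "normalized_units G" "units_of (int_adjoin \<theta>)" \<pi>\<^sub>1
    by (rule group_hom.intro[OF N.is_group U.is_group]) (rule group_hom_axioms.intro[OF \<pi>_hom])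

  have "\<pi>\<^sub>1 (hoechsmann_unit G g (p ^ n) t r i) = cyc_h \<theta> t i" for i
  proof -
    have "\<theta> ^ (t ^ i) \<noteq> 1"
      using root_of_unity_coprime_pow_eq_1[OF \<theta>, of "t ^ i"] tpn theta_ne_1 by auto
    thus ?thesis
      using hoechsmann_unit_normalized(1)[OF primitive t_pos tpn r', of i]
        hoechsmann_unit_normalized(2)[OF primitive t_pos tpn r' \<theta> theta_ne_1, of i]
      by (simp add: \<pi> normalized_units_in_group_ring theta_ne_1 cyc_h_eq_cyclotomic_quotient)
  qed
  hence "\<pi>\<^sub>1 ` S = U\<^sub>0" by (simp add: S_def U_def \<pi>_g image_image)
  hence image: "\<pi>\<^sub>1 ` generate (normalized_units G) S = generate (units_of (int_adjoin \<theta>)) U\<^sub>0"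
    using \<pi>.generate_img[OF S] by simp

  have sub: "subgroup (generate (normalized_units G) S) (normalized_units G)"
    by (rule N.generate_is_subgroup[OF S])
  have inj: "inj_on \<pi>\<^sub>1 (generate (normalized_units G) S)"
  proof (rule inj_onI)
    fix x y assume xy: "x \<in> generate (normalized_units G) S" "y \<in> generate (normalized_units G) S"
      and eq: "\<pi>\<^sub>1 x = \<pi>\<^sub>1 y"
    have carr: "x \<in> carrier (normalized_units G)" "y \<in> carrier (normalized_units G)"
      using xy subgroup.mem_carrier[OF sub] by blast+
    define u where "u = x \<otimes>\<^bsub>normalized_units G\<^esub> inv\<^bsub>normalized_units G\<^esub> y"
    have u: "u \<in> generate (normalized_units G) S"
      unfolding u_def using xy by (intro subgroup.m_closed[OF sub] subgroup.m_inv_closed[OF sub])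
    have uc: "u \<in> carrier (normalized_units G)" using u subgroup.mem_carrier[OF sub] by blast
    have "\<pi>\<^sub>1 u = \<one>\<^bsub>units_of (int_adjoin \<theta>)\<^esub>"
      unfolding u_def using carr eq by simp
    hence "\<pi>\<^sub>1 u = 1"
      by (simp add: units_of_one int_adjoin_def ring_of_type_algebra_def)
    hence "char_eval \<theta> u = 1"
      using \<pi>[OF normalized_units_in_group_ring[OF uc]] by simp
    hence "u = \<one>\<^bsub>normalized_units G\<^esub>"
      by (intro norm_compatible_kernel_trivial uc norm_compatible_generate[OF S comp u])
    thus "x = y" using carr unfolding u_def by (metis N.inv_equality N.inv_inv N.inv_closed)
  qed
  have "\<pi>\<^sub>1 \<in> iso ((normalized_units G)\<lparr>carrier := generate (normalized_units G) S\<rparr>)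
      ((units_of (int_adjoin \<theta>))\<lparr>carrier := generate (units_of (int_adjoin \<theta>)) U\<^sub>0\<rparr>)"
    unfolding iso_def bij_betw_def
    using \<pi>.hom_mult subgroup.mem_carrier[OF sub] image inj by (auto simp: hom_def)
  thus ?thesis by (rule is_isoI)
qed

end
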